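(* Let $k,n$ be positive integers and let $G$ be a connected graph with $n$ vertices. Then: (i) $G$ has a spanning subgraph belonging to $\mathcal{F}_{k,n}$ if and only if $G=G_1*_{k'}G_2$ for some integer $k'\ge k$ and graphs $G_1,G_2$ such that, for each $i=1,2$, either $\eta(G_i)\ge k$ or $G_i=K_1$. (ii) $G$ is a spanning subgraph of some graph belonging to $\mathcal{F}_{k,n}$ if and only if $\kappa'(G)\le k$ and $\gamma(G)\le k$.
   Context: Graphs are finite, loopless, possibly with multiple edges. $\kappa'(G)$ is the edge connectivity; $\tau(G)$ is the maximum number of edge-disjoint spanning trees of a connected graph $G$. $\omega(G)$ is the number of components. For a nontrivial graph $G$, $d(G)=\frac{|E(G)|}{|V(G)|-\omega(G)}$, $\eta(G)=\min\frac{|X|}{\omega(G-X)-\omega(G)}$ over $X\subseteq E(G)$ with nonzero denominator, and $\gamma(G)=\max d(H)$ over subgraphs $H$ of $G$ with nonzero denominator. For vertex-disjoint connected graphs $G_1,G_2$ and a set $K$ of $m$ edges each having one end in $V(G_1)$ and the other in $V(G_2)$, the $m$-edge-join $G_1*_m G_2$ is the graph with vertex set $V(G_1)\cup V(G_2)$ and edge set $E(G_1)\cup E(G_2)\cup K$. For $n>1$, $\mathcal{F}_{k,n}$ is the set of graphs $H$ on $n$ vertices with $\kappa'(H)=\tau(H)=k$ whose number of edges is minimum among all graphs on $n$ vertices with $\kappa'=\tau=k$. *)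

theory Defs
  imports Complex_Main "HOL-Library.Multiset"
begin

type_synonym 'a mgraph = "'a set \<times> 'a set multiset"

definition verts :: "'a mgraph \<Rightarrow> 'a set" where "verts G = fst G"
definition edges :: "'a mgraph \<Rightarrow> 'a set multiset" where "edges G = snd G"

definition wf_graph :: "'a mgraph \<Rightarrow> bool" where
  "wf_graph G \<longleftrightarrow> finite (verts G) \<and> (\<forall>e\<in>#edges G. card e = 2 \<and> e \<subseteq> verts G)"

definition adj :: "'a mgraph \<Rightarrow> 'a \<Rightarrow> 'a \<Rightarrow> bool" where
  "adj G u v \<longleftrightarrow> {u, v} \<in># edges G"

definition reach :: "'a mgraph \<Rightarrow> 'a \<Rightarrow> 'a \<Rightarrow> bool" where
  "reach G = (adj G)\<^sup>*\<^sup>*"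

definition connected_graph :: "'a mgraph \<Rightarrow> bool" where
  "connected_graph G \<longleftrightarrow> verts G \<noteq> {} \<and> (\<forall>u\<in>verts G. \<forall>v\<in>verts G. reach G u v)"

definition ncomp :: "'a mgraph \<Rightarrow> nat" where
  "ncomp G = card (verts G // {(u, v). u \<in> verts G \<and> v \<in> verts G \<and> reach G u v})"

definition subgraph :: "'a mgraph \<Rightarrow> 'a mgraph \<Rightarrow> bool" where
  "subgraph H G \<longleftrightarrow> verts H \<subseteq> verts G \<and> edges H \<subseteq># edges G \<and>
     (\<forall>e\<in>#edges H. e \<subseteq> verts H)"

definition spanning_subgraph :: "'a mgraph \<Rightarrow> 'a mgraph \<Rightarrow> bool" where
  "spanning_subgraph H G \<longleftrightarrow> verts H = verts G \<and> edges H \<subseteq># edges G"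

definition del_edges :: "'a mgraph \<Rightarrow> 'a set multiset \<Rightarrow> 'a mgraph" where
  "del_edges G X = (verts G, edges G - X)"

definition induced :: "'a mgraph \<Rightarrow> 'a set \<Rightarrow> 'a mgraph" where
  "induced G S = (S, filter_mset (\<lambda>e. e \<subseteq> S) (edges G))"

definition edge_conn :: "'a mgraph \<Rightarrow> nat" where
  "edge_conn G = Inf {size X | X. X \<subseteq># edges G \<and> \<not> connected_graph (del_edges G X)}"

definition spanning_tree :: "'a mgraph \<Rightarrow> 'a set multiset \<Rightarrow> bool" where
  "spanning_tree G T \<longleftrightarrow> T \<subseteq># edges G \<and> connected_graph (verts G, T) \<and>
     size T = card (verts G) - 1"

definition tree_pack :: "'a mgraph \<Rightarrow> nat" where
  "tree_pack G = Sup {length Ts | Ts. (\<forall>T\<in>set Ts. spanning_tree G T) \<and>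
                                       sum_list Ts \<subseteq># edges G}"

definition dens :: "'a mgraph \<Rightarrow> real" where
  "dens G = real (size (edges G)) / (real (card (verts G)) - real (ncomp G))"

definition eta :: "'a mgraph \<Rightarrow> real" where
  "eta G = Min {real (size X) / (real (ncomp (del_edges G X)) - real (ncomp G)) | X.
                 X \<subseteq># edges G \<and> real (ncomp (del_edges G X)) - real (ncomp G) \<noteq> 0}"

definition gamma :: "'a mgraph \<Rightarrow> real" where
  "gamma G = Max {dens H | H. subgraph H G \<and> real (card (verts H)) - real (ncomp H) \<noteq> 0}"

text \<open>G = G1 *_m G2 with G1 = G[V1], G2 = G[V2]: V(G) is partitioned into V1, V2,
  G1, G2 are connected and exactly m edges join V1 and V2.\<close>
definition edge_join :: "'a mgraph \<Rightarrow> 'a set \<Rightarrow> 'a set \<Rightarrow> nat \<Rightarrow> bool" where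
  "edge_join G V1 V2 m \<longleftrightarrow> V1 \<inter> V2 = {} \<and> V1 \<union> V2 = verts G \<and>
     connected_graph (induced G V1) \<and> connected_graph (induced G V2) \<and>
     size (filter_mset (\<lambda>e. e \<inter> V1 \<noteq> {} \<and> e \<inter> V2 \<noteq> {}) (edges G)) = m"

definition Fam :: "nat \<Rightarrow> nat \<Rightarrow> 'a mgraph set" where
  "Fam k n = {H. wf_graph H \<and> card (verts H) = n \<and> edge_conn H = k \<and> tree_pack H = k \<and>
     (\<forall>H'::'a mgraph. wf_graph H' \<and> card (verts H') = n \<and> edge_conn H' = k \<and> tree_pack H' = k
        \<longrightarrow> size (edges H) \<le> size (edges H'))}"

end

theory Submission
  imports Defs
begin

text \<open>A graph in the family is a union of \<open>k\<close> edge-disjoint spanning trees with an edge cut of size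
  \<open>k\<close>; each tree then crosses the cut exactly once, so it restricts to a spanning tree on either
  side. Conversely, \<open>k\<close> disjoint spanning trees on either side and \<open>k\<close> crossing edges glue to
  \<open>k\<close> disjoint spanning trees of the whole. By the theorems of Nash-Williams and Tutte, trees inside
  a side exist when its strength is at least \<open>k\<close>, and a side is covered by \<open>k\<close> trees (after adding
  edges) when its density is at most \<open>k\<close>. Both theorems follow from matroid union: for a packing of
  \<open>k\<close> forests of maximum total size, let \<open>A\<close> be the set of edges left uncovered by some packing
  reachable through fundamental-circuit exchanges. Every forest spans \<open>A\<close> within \<open>A\<close>, and every
  edge outside \<open>A\<close> is covered.\<close>

section \<open>Matroid union for copies of one matroid\<close>

text \<open>The family is defined by minimality alone, so its shape rests on a count: packing number
  k forces at least k(n - 1) edges, and for n at least 2 repeating one tree k times on all vertices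
  but one, plus k parallel edges to the last vertex, attains this. Hence a member has no edge
  outside its k trees, which is what bounds the density of its subgraphs. Parallel edges are equal
  as sets. A second copy of an edge is spanned by the first, so no forest holds two copies: a forest
  is a plain set, multiplicities live only in the multisets \<open>E\<close> and
  \<open>covered k F\<close>, and an exchange asks only whether some copy is still free. Strength
  and density enter as integer inequalities, k(c - 1) \<le> |X| and |D| \<le> k(|W| - c) with c a
  number of components; both hold trivially where the quotient is undefined. Packing tests the first
  on a single \<open>X\<close>, the edges outside \<open>A\<close>; covering tests the second on a
  single \<open>D\<close>, the edges inside \<open>A\<close>.\<close>

locale closure_matroid =
  fixes cl :: "'e set \<Rightarrow> 'e set"
  assumes subset_cl: "X \<subseteq> cl X"
    and cl_mono: "X \<subseteq> Y \<Longrightarrow> cl X \<subseteq> cl Y"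
    and cl_idem: "cl (cl X) = cl X"
    and exchange: "\<lbrakk>e \<in> cl (insert f X); e \<notin> cl X\<rbrakk> \<Longrightarrow> f \<in> cl (insert e X)"
begin

definition indep :: "'e set \<Rightarrow> bool" where
  "indep X \<longleftrightarrow> (\<forall>e\<in>X. e \<notin> cl (X - {e}))"

lemma cl_subset_cl: "X \<subseteq> cl Y \<Longrightarrow> cl X \<subseteq> cl Y"
  using cl_mono cl_idem by metis

lemma not_mem_if_not_mem_cl: "e \<notin> cl X \<Longrightarrow> e \<notin> X"
  using subset_cl[of X] by blast

lemma indep_empty: "indep {}"
  by (simp add: indep_def)

lemma indep_mono: "\<lbrakk>indep Y; X \<subseteq> Y\<rbrakk> \<Longrightarrow> indep X"
  unfolding indep_def using cl_mono[of "X - {e}" "Y - {e}" for e] by blast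

lemma indep_insert:
  assumes "indep X" "e \<notin> cl X"
  shows "indep (insert e X)"
  unfolding indep_def
proof
  fix f assume f: "f \<in> insert e X"
  have e: "e \<notin> X" using assms(2) subset_cl by blast
  show "f \<notin> cl (insert e X - {f})"
  proof (cases "f = e")
    case True
    then show ?thesis using e assms(2) by simp
  next
    case False
    then have fX: "f \<in> X" using f by simp
    show ?thesis
    proof
      assume "f \<in> cl (insert e X - {f})"
      then have "f \<in> cl (insert e (X - {f}))" using False by (simp add: insert_Diff_if)
      moreover have "f \<notin> cl (X - {f})" using assms(1) fX unfolding indep_def by blast
      ultimately have "e \<in> cl (insert f (X - {f}))" by (rule exchange)
      then show False using assms(2) fX by (simp add: insert_absorb)
    qed
  qed
qed

text \<open>The set on the right is the fundamental circuit of \<open>e\<close> without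
  \<open>e\<close>, that is, the elements \<open>e\<close> may replace (just {e} if \<open>e\<close>
  lies in \<open>F\<close>). A minimal subset of \<open>F\<close> spanning \<open>e\<close> consists
  of such elements only: otherwise exchange would put some \<open>f\<close> into the span of
  \<open>F - {f}\<close>.\<close>

lemma mem_cl_circuit:
  assumes "finite F" "indep F" "e \<in> cl F"
  shows "e \<in> cl {f \<in> F. e \<notin> cl (F - {f})}"
proof -
  define S where "S = {D. D \<subseteq> F \<and> e \<in> cl D}"
  have "finite S" "F \<in> S" unfolding S_def using assms by auto
  then obtain D where D: "D \<in> S" and min: "\<And>D'. D' \<in> S \<Longrightarrow> D' \<subseteq> D \<Longrightarrow> D' = D"
    using finite_has_minimal[of S] by blast
  have "D \<subseteq> {f \<in> F. e \<notin> cl (F - {f})}"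
  proof
    fix f assume f: "f \<in> D"
    have fF: "f \<in> F" and DF: "D \<subseteq> F" using f D unfolding S_def by auto
    have nD: "e \<notin> cl (D - {f})" using min[of "D - {f}"] f DF unfolding S_def by auto
    have "e \<in> cl (insert f (D - {f}))" using D f unfolding S_def by (simp add: insert_absorb)
    then have "f \<in> cl (insert e (D - {f}))" using nD by (rule exchange)
    also have "cl (insert e (D - {f})) \<subseteq> cl (insert e (F - {f}))"
      using DF by (intro cl_mono) auto
    finally have f1: "f \<in> cl (insert e (F - {f}))" .
    have "e \<notin> cl (F - {f})"
    proof
      assume "e \<in> cl (F - {f})"
      then have "insert e (F - {f}) \<subseteq> cl (F - {f})" using subset_cl[of "F - {f}"] by simp
      then have "f \<in> cl (F - {f})" using f1 cl_subset_cl by (meson subsetD)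
      then show False using assms(2) fF unfolding indep_def by blast
    qed
    then show "f \<in> {f \<in> F. e \<notin> cl (F - {f})}" using fF by simp
  qed
  then have "cl D \<subseteq> cl {f \<in> F. e \<notin> cl (F - {f})}" by (rule cl_mono)
  then show ?thesis using D unfolding S_def by blast
qed

lemma basis_extension:
  assumes "finite P" "indep F" "F \<subseteq> P"
  obtains B where "F \<subseteq> B" "B \<subseteq> P" "indep B" "P \<subseteq> cl B"
proof -
  define S where "S = {B. F \<subseteq> B \<and> B \<subseteq> P \<and> indep B}"
  have "finite S" "F \<in> S" unfolding S_def using assms by auto
  then obtain B where B: "B \<in> S" and max: "\<And>B'. B' \<in> S \<Longrightarrow> B \<subseteq> B' \<Longrightarrow> B' = B"
    using finite_has_maximal[of S] by blast
  have "P \<subseteq> cl B"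
  proof
    fix e assume e: "e \<in> P"
    show "e \<in> cl B"
    proof (rule ccontr)
      assume ne: "e \<notin> cl B"
      then have "insert e B \<in> S" using B e indep_insert unfolding S_def by auto
      then have "insert e B = B" using max by blast
      then show False using not_mem_if_not_mem_cl[OF ne] by blast
    qed
  qed
  then show ?thesis using that B unfolding S_def by blast
qed

section \<open>Packings of independent sets and single exchanges\<close>

definition covered :: "nat \<Rightarrow> (nat \<Rightarrow> 'e set) \<Rightarrow> 'e multiset" where
  "covered k F = (\<Sum>i<k. mset_set (F i))"

definition packing :: "nat \<Rightarrow> 'e multiset \<Rightarrow> (nat \<Rightarrow> 'e set) \<Rightarrow> bool" where
  "packing k E F \<longleftrightarrow> (\<forall>i<k. finite (F i) \<and> indep (F i)) \<and> covered k F \<subseteq># E"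

text \<open>A free copy of \<open>e\<close> enters and \<open>f\<close> leaves. In a packing of
  maximum size \<open>F i\<close> spans every edge with a free copy, so \<open>f\<close> then ranges
  exactly over the fundamental circuit of \<open>e\<close>.\<close>

definition exchange_step ::
    "nat \<Rightarrow> 'e multiset \<Rightarrow> (nat \<Rightarrow> 'e set) \<Rightarrow> (nat \<Rightarrow> 'e set) \<Rightarrow> bool" where
  "exchange_step k E F F' \<longleftrightarrow> (\<exists>i<k. \<exists>e. \<exists>f\<in>F i. add_mset e (covered k F) \<subseteq># E \<and>
     e \<notin> cl (F i - {f}) \<and> F' = F(i := insert e (F i - {f})))"

text \<open>Stated with sums on both sides because subtraction of multisets truncates.\<close>

lemma covered_upd:
  assumes "i < k"
  shows "covered k (F(i := X)) + mset_set (F i) = covered k F + mset_set X"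
proof -
  have "covered k F = mset_set (F i) + (\<Sum>j\<in>{..<k} - {i}. mset_set (F j))"
    unfolding covered_def using assms by (simp add: sum.remove)
  moreover have "covered k (F(i := X)) = mset_set X + (\<Sum>j\<in>{..<k} - {i}. mset_set (F j))"
    unfolding covered_def using assms by (simp add: sum.remove)
  ultimately show ?thesis by (simp add: ac_simps)
qed

lemma covered_insert:
  assumes "i < k" "finite (F i)" "e \<notin> F i"
  shows "covered k (F(i := insert e (F i))) = add_mset e (covered k F)"
  using covered_upd[OF assms(1), of F "insert e (F i)"] assms(2,3) by simp

lemma covered_exchange:
  assumes "i < k" "finite (F i)" "f \<in> F i" "e \<notin> F i - {f}"
  shows "add_mset f (covered k (F(i := insert e (F i - {f})))) = add_mset e (covered k F)"
proof -
  have "mset_set (F i) = add_mset f (mset_set (F i - {f}))"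
    using assms by (simp add: mset_set.remove)
  moreover have "mset_set (insert e (F i - {f})) = add_mset e (mset_set (F i - {f}))"
    using assms by (subst mset_set.insert) auto
  ultimately show ?thesis
    using covered_upd[OF assms(1), of F "insert e (F i - {f})"] by simp
qed

theorem matroid_union:
  obtains F A where "packing k E F" "\<And>i. i < k \<Longrightarrow> A \<subseteq> cl (F i \<inter> A)"
    "filter_mset (\<lambda>e. e \<notin> A) E \<subseteq># covered k F"
proof -
  let ?size = "\<lambda>F. size (covered k F)"
  have "packing k E (\<lambda>_. {})" by (simp add: packing_def covered_def indep_empty)
  moreover have "packing k E F \<Longrightarrow> ?size F < Suc (size E)" for F
    by (simp add: packing_def size_mset_mono less_Suc_eq_le)
  ultimately obtain F0 where F0: "packing k E F0"
    and max: "\<And>F. packing k E F \<Longrightarrow> ?size F \<le> ?size F0"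
    using ex_has_greatest_nat[of "packing k E" "\<lambda>_. {}" ?size "Suc (size E)"] by auto
  let ?reachable = "(exchange_step k E)\<^sup>*\<^sup>* F0"
  \<comment> \<open>Free copies are collected over all reachable packings, not just
    \<open>F0\<close>; this makes \<open>A\<close> closed under taking the elements of fundamental
    circuits.\<close>
  define A where "A = {e. \<exists>F. ?reachable F \<and> add_mset e (covered k F) \<subseteq># E}"
  have step: "packing k E F' \<and> ?size F' = ?size F"
    if F: "packing k E F" and s: "exchange_step k E F F'" for F F'
  proof -
    obtain i e f where i: "i < k" and f: "f \<in> F i" and e: "add_mset e (covered k F) \<subseteq># E"
      "e \<notin> cl (F i - {f})" and F': "F' = F(i := insert e (F i - {f}))"
      using s unfolding exchange_step_def by blast
    have Fi: "finite (F i)" "indep (F i)" using F i unfolding packing_def by auto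
    have eF: "e \<notin> F i - {f}" using not_mem_if_not_mem_cl[OF e(2)] .
    have tot: "add_mset f (covered k F') = add_mset e (covered k F)"
      unfolding F' by (rule covered_exchange[where F = F, OF i Fi(1) f eF])
    have "indep (insert e (F i - {f}))"
      using indep_insert[OF _ e(2)] indep_mono[OF Fi(2)] by blast
    then have "finite (F' j) \<and> indep (F' j)" if "j < k" for j
      using F Fi that unfolding packing_def F' by (cases "j = i") simp_all
    moreover have "covered k F' \<subseteq># E"
      using e(1) unfolding tot[symmetric]
      by (metis diff_subset_eq_self insert_subset_eq_iff subset_mset.trans)
    ultimately have "packing k E F'" unfolding packing_def by blast
    then show ?thesis using arg_cong[OF tot, of size] by simp
  qed
  have inv: "packing k E F \<and> ?size F = ?size F0" if "?reachable F" for F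
    using that by (induction rule: rtranclp_induct) (use F0 step in auto)
  \<comment> \<open>A free edge outside the span of \<open>F i\<close> could be added to it, giving
    a larger packing.\<close>
  have span: "e \<in> cl (F i)"
    if R: "?reachable F" and e: "add_mset e (covered k F) \<subseteq># E" and i: "i < k" for F e i
  proof (rule ccontr)
    assume ne: "e \<notin> cl (F i)"
    have F: "packing k E F" and sz: "?size F = ?size F0" using inv[OF R] by auto
    have Fi: "finite (F i)" "indep (F i)" using F i unfolding packing_def by auto
    have tot: "covered k (F(i := insert e (F i))) = add_mset e (covered k F)"
      using covered_insert[where F = F, OF i Fi(1)] not_mem_if_not_mem_cl[OF ne] by blast
    have "packing k E (F(i := insert e (F i)))"
      using F Fi e indep_insert[OF Fi(2) ne] unfolding packing_def tot by auto
    from max[OF this] show False unfolding tot using sz by simp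
  qed
  \<comment> \<open>After the exchange the displaced \<open>f\<close> is the one with a free
    copy.\<close>
  have exch: "f \<in> A"
    if R: "?reachable F" and e: "add_mset e (covered k F) \<subseteq># E" and i: "i < k" and f: "f \<in> F i"
      and n: "e \<notin> cl (F i - {f})" for F e i f
  proof -
    have Fi: "finite (F i)" using inv[OF R] i unfolding packing_def by auto
    define F' where "F' = F(i := insert e (F i - {f}))"
    have "exchange_step k E F F'" using i e f n unfolding exchange_step_def F'_def by blast
    then have "?reachable F'" using R by simp
    moreover have "add_mset f (covered k F') = add_mset e (covered k F)"
      unfolding F'_def using covered_exchange[where F = F, OF i Fi f not_mem_if_not_mem_cl[OF n]] .
    ultimately show ?thesis using e unfolding A_def by auto
  qed
  have spanA: "e \<in> cl (F i \<inter> A)"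
    if R: "?reachable F" and e: "add_mset e (covered k F) \<subseteq># E" and i: "i < k" for F e i
  proof -
    have Fi: "finite (F i)" "indep (F i)" using inv[OF R] i unfolding packing_def by auto
    have "e \<in> cl {f \<in> F i. e \<notin> cl (F i - {f})}"
      using mem_cl_circuit[OF Fi span[OF R e i]] .
    moreover have "{f \<in> F i. e \<notin> cl (F i - {f})} \<subseteq> F i \<inter> A" using exch[OF R e i] by blast
    ultimately show ?thesis using cl_mono by (metis subsetD)
  qed
  \<comment> \<open>Elements of \<open>A\<close> are witnessed by different packings, but the
    conclusion concerns \<open>F0\<close> alone. An exchange swaps two elements of \<open>A\<close>
    that span each other modulo the rest of \<open>F i \<inter> A\<close>, so the span stays the
    same along the way.\<close>
  have span_const: "cl (F j \<inter> A) = cl (F0 j \<inter> A)" if "?reachable F" for F j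
    using that
  proof (induction rule: rtranclp_induct)
    case base
    show ?case by simp
  next
    case (step F F')
    obtain i e f where i: "i < k" and f: "f \<in> F i" and e: "add_mset e (covered k F) \<subseteq># E"
      "e \<notin> cl (F i - {f})" and F': "F' = F(i := insert e (F i - {f}))"
      using step.hyps(2) unfolding exchange_step_def by blast
    show ?case
    proof (cases "j = i")
      case False
      then show ?thesis using step.IH F' by simp
    next
      case True
      let ?X = "F i \<inter> A - {f}"
      have eA: "e \<in> A" using step.hyps(1) e(1) unfolding A_def by blast
      have fA: "f \<in> A" using exch[OF step.hyps(1) e(1) i f e(2)] .
      have FA: "F i \<inter> A = insert f ?X" using f fA by auto
      have F'A: "F' i \<inter> A = insert e ?X" unfolding F' using eA by auto
      have e1: "e \<in> cl (insert f ?X)" using spanA[OF step.hyps(1) e(1) i] FA by simp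
      have "e \<notin> cl ?X" using e(2) cl_mono[of ?X "F i - {f}"] by blast
      then have f1: "f \<in> cl (insert e ?X)" using exchange e1 by blast
      have "insert e ?X \<subseteq> cl (insert f ?X)" "insert f ?X \<subseteq> cl (insert e ?X)"
        using e1 f1 subset_cl[of "insert f ?X"] subset_cl[of "insert e ?X"] by auto
      then have "cl (insert f ?X) = cl (insert e ?X)"
        by (intro equalityI cl_subset_cl)
      then show ?thesis using step.IH True FA F'A by simp
    qed
  qed
  show thesis
  proof (rule that[OF F0])
    show "A \<subseteq> cl (F0 i \<inter> A)" if "i < k" for i
    proof
      fix e assume "e \<in> A"
      then obtain F where F: "?reachable F" "add_mset e (covered k F) \<subseteq># E"
        unfolding A_def by blast
      then show "e \<in> cl (F0 i \<inter> A)" using spanA[OF F that] span_const[OF F(1)] by simp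
    qed
    show "filter_mset (\<lambda>e. e \<notin> A) E \<subseteq># covered k F0"
    proof (rule mset_subset_eqI)
      fix e
      show "count (filter_mset (\<lambda>e. e \<notin> A) E) e \<le> count (covered k F0) e"
      proof (cases "e \<in> A")
        case False
        then have n: "\<not> add_mset e (covered k F0) \<subseteq># E" unfolding A_def by blast
        have sub: "covered k F0 \<subseteq># E" using F0 unfolding packing_def by blast
        show ?thesis
        proof (rule ccontr)
          assume "\<not> ?thesis"
          then have "count (covered k F0) e < count E e" using False by simp
          then have "add_mset e (covered k F0) \<subseteq># E"
            using sub by (simp add: insert_subset_eq_iff subseteq_mset_def Suc_le_eq)
          then show False using n by simp
        qed
      qed simp
    qed
  qed
qed

end

section \<open>Connectivity and the graphic matroid\<close>

definition conn :: "'a set set \<Rightarrow> 'a \<Rightarrow> 'a \<Rightarrow> bool" where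
  "conn X = (\<lambda>u v. {u, v} \<in> X)\<^sup>*\<^sup>*"

lemma conn_refl [simp]: "conn X u u"
  by (simp add: conn_def)

lemma conn_edge: "{u, v} \<in> X \<Longrightarrow> conn X u v"
  by (auto simp: conn_def)

lemma conn_trans: "\<lbrakk>conn X u v; conn X v w\<rbrakk> \<Longrightarrow> conn X u w"
  unfolding conn_def by (rule rtranclp_trans)

lemma conn_sym: "conn X u v \<Longrightarrow> conn X v u"
proof -
  have "symp (\<lambda>u v. {u, v} \<in> X)\<^sup>*\<^sup>*"
    by (rule symp_rtranclp) (simp add: symp_def insert_commute)
  then show "conn X u v \<Longrightarrow> conn X v u" by (simp add: conn_def sympD)
qed

lemma conn_least:
  assumes "conn X u v" "\<And>a b. {a, b} \<in> X \<Longrightarrow> conn Y a b"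
  shows "conn Y u v"
  using assms(1) unfolding conn_def[of X]
proof (induction rule: rtranclp_induct)
  case (step y z)
  then show ?case using conn_trans[OF step.IH assms(2)] by simp
qed simp

lemma conn_mono: "\<lbrakk>conn X u v; X \<subseteq> Y\<rbrakk> \<Longrightarrow> conn Y u v"
  by (erule conn_least) (auto intro: conn_edge)

lemma conn_stays:
  assumes "conn X u v" "u \<in> S" "\<And>a b. \<lbrakk>{a, b} \<in> X; a \<in> S\<rbrakk> \<Longrightarrow> b \<in> S"
  shows "v \<in> S"
  using assms(1,2) unfolding conn_def
  by (induction rule: rtranclp_induct) (use assms(3) in auto)

text \<open>A walk using the new edge several times can be shortened to use it at most once, in one
  of the two directions.\<close>

lemma conn_insert:
  "conn (insert {a, b} X) u v \<longleftrightarrow>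
     conn X u v \<or> conn X u a \<and> conn X b v \<or> conn X u b \<and> conn X a v"
  (is "?L \<longleftrightarrow> ?R v")
proof
  assume ?L
  then show "?R v" unfolding conn_def[of "insert {a, b} X"]
  proof (induction rule: rtranclp_induct)
    case (step y z)
    consider "{y, z} \<in> X" | "y = a" "z = b" | "y = b" "z = a"
      using step.hyps(2) by (auto simp: doubleton_eq_iff)
    then show ?case
    proof cases
      case 1
      then show ?thesis using step.IH conn_edge[OF 1] conn_trans by meson
    qed (use step.IH in auto)
  qed simp
next
  have ab: "conn (insert {a, b} X) a b" by (simp add: conn_edge)
  have up: "conn X x y \<Longrightarrow> conn (insert {a, b} X) x y" for x y
    by (rule conn_mono) auto
  assume "?R v"
  then show ?L using up ab conn_trans conn_sym by meson
qed

text \<open>Members of \<open>X\<close> that are not of the form \<open>{u, v}\<close> do not affect \<open>conn X\<close>; keeping them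
  in the closure makes this an operator on all sets of sets.\<close>
definition edge_cl :: "'a set set \<Rightarrow> 'a set set" where
  "edge_cl X = X \<union> {{u, v} | u v. conn X u v}"

lemma pair_mem_edge_cl: "{u, v} \<in> edge_cl X \<longleftrightarrow> conn X u v"
proof
  assume "{u, v} \<in> edge_cl X"
  then show "conn X u v"
    unfolding edge_cl_def using conn_edge conn_sym by (auto simp: doubleton_eq_iff)
qed (auto simp: edge_cl_def)

lemma conn_edge_cl: "conn (edge_cl X) u v \<longleftrightarrow> conn X u v"
proof
  assume "conn (edge_cl X) u v"
  then show "conn X u v" by (rule conn_least) (simp add: pair_mem_edge_cl)
next
  assume "conn X u v"
  then show "conn (edge_cl X) u v" by (simp add: conn_edge pair_mem_edge_cl)
qed

lemma conn_insert_not_pair: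
  assumes "\<nexists>a b. f = {a, b}"
  shows "conn (insert f X) u v \<longleftrightarrow> conn X u v"
proof -
  have "{a, b} \<noteq> f" for a b using assms by blast
  then show ?thesis by (simp add: conn_def)
qed

interpretation graphic: closure_matroid edge_cl
proof
  show "X \<subseteq> edge_cl X" for X :: "'a set set" by (simp add: edge_cl_def)
  show "X \<subseteq> Y \<Longrightarrow> edge_cl X \<subseteq> edge_cl Y" for X Y :: "'a set set"
    unfolding edge_cl_def by (auto intro: conn_mono)
  show "edge_cl (edge_cl X) = edge_cl X" for X :: "'a set set"
    unfolding edge_cl_def[of "edge_cl X"] conn_edge_cl by (auto simp: edge_cl_def)
  fix X and e f :: "'a set"
  assume e: "e \<in> edge_cl (insert f X)" and ne: "e \<notin> edge_cl X"
  show "f \<in> edge_cl (insert e X)"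
  proof (cases "e = f")
    case True
    then show ?thesis by (simp add: edge_cl_def)
  next
    case False
    then obtain u v where uv: "e = {u, v}" "conn (insert f X) u v"
      using e ne by (auto simp: edge_cl_def)
    have nc: "\<not> conn X u v" using ne uv pair_mem_edge_cl by metis
    then obtain a b where ab: "f = {a, b}" using uv(2) conn_insert_not_pair by metis
    have "conn X a u \<and> conn X v b \<or> conn X a v \<and> conn X u b"
      using uv(2) nc conn_sym[of X u] conn_sym[of X b] conn_sym[of X _ v] unfolding ab conn_insert
      by blast
    then have "conn (insert {u, v} X) a b" by (simp add: conn_insert)
    then show ?thesis unfolding ab uv(1) by (simp add: pair_mem_edge_cl)
  qed
qed

section \<open>Components and the rank of an edge set\<close>

definition comp_of :: "'a set \<Rightarrow> 'a set set \<Rightarrow> 'a \<Rightarrow> 'a set" where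
  "comp_of V X u = {v \<in> V. conn X u v}"

definition ncomps :: "'a set \<Rightarrow> 'a set set \<Rightarrow> nat" where
  "ncomps V X = card (comp_of V X ` V)"

lemma comp_of_eq_iff:
  assumes "u \<in> V" "v \<in> V"
  shows "comp_of V X u = comp_of V X v \<longleftrightarrow> conn X u v"
proof
  assume "comp_of V X u = comp_of V X v"
  then have "v \<in> comp_of V X u" using assms(2) by (simp add: comp_of_def)
  then show "conn X u v" by (simp add: comp_of_def)
next
  assume "conn X u v"
  then have "conn X u x \<longleftrightarrow> conn X v x" for x by (meson conn_sym conn_trans)
  then show "comp_of V X u = comp_of V X v" by (simp add: comp_of_def)
qed

lemma reach_eq_conn: "reach G = conn (set_mset (edges G))"
  by (simp add: reach_def adj_def[abs_def] conn_def)

lemma ncomp_eq_ncomps: "ncomp G = ncomps (verts G) (set_mset (edges G))"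
proof -
  have "verts G // {(u, v). u \<in> verts G \<and> v \<in> verts G \<and> reach G u v} =
      comp_of (verts G) (set_mset (edges G)) ` verts G"
    unfolding quotient_def reach_eq_conn comp_of_def by auto
  then show ?thesis by (simp add: ncomp_def ncomps_def)
qed

text \<open>Each class of \<open>Y\<close> on \<open>V\<close> is a union of classes of
  \<open>X\<close>; \<open>g\<close> sends a class of \<open>X\<close> to the one around it, by way
  of a chosen representative, and is onto.\<close>

lemma ncomps_antimono:
  assumes "finite V" "\<And>u v. \<lbrakk>u \<in> V; v \<in> V; conn X u v\<rbrakk> \<Longrightarrow> conn Y u v"
  shows "ncomps V Y \<le> ncomps V X"
proof -
  define g where "g C = comp_of V Y (SOME v. v \<in> C)" for C
  have "comp_of V Y u = g (comp_of V X u)" if u: "u \<in> V" for u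
  proof -
    have "u \<in> comp_of V X u" using u by (simp add: comp_of_def)
    then have "(SOME v. v \<in> comp_of V X u) \<in> comp_of V X u" by (rule someI)
    then show ?thesis unfolding g_def using u assms(2)
      by (subst comp_of_eq_iff) (auto simp: comp_of_def)
  qed
  then have "comp_of V Y ` V = g ` (comp_of V X ` V)" unfolding image_image by (rule image_cong[OF refl])
  then show ?thesis unfolding ncomps_def using assms(1) by (simp add: card_image_le)
qed

lemma ncomps_cong:
  assumes "\<And>u v. \<lbrakk>u \<in> V; v \<in> V\<rbrakk> \<Longrightarrow> conn X u v \<longleftrightarrow> conn Y u v"
  shows "ncomps V X = ncomps V Y"
proof -
  have "comp_of V X ` V = comp_of V Y ` V"
    using assms by (intro image_cong) (auto simp: comp_of_def)
  then show ?thesis by (simp add: ncomps_def)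
qed

lemma ncomps_empty [simp]: "ncomps V {} = card V"
proof -
  have "conn {} u v \<longleftrightarrow> u = v" for u v :: 'a
  proof
    assume "conn {} u v"
    then show "u = v" using conn_stays[of "{}" u v "{u}"] by auto
  qed simp
  then have "inj_on (comp_of V {}) V" by (auto simp: inj_on_def comp_of_eq_iff)
  then show ?thesis by (simp add: ncomps_def card_image)
qed

lemma ncomps_le_card: "finite V \<Longrightarrow> ncomps V X \<le> card V"
  by (simp add: ncomps_def card_image_le)

lemma ncomps_pos: "\<lbrakk>finite V; V \<noteq> {}\<rbrakk> \<Longrightarrow> 0 < ncomps V X"
  by (simp add: ncomps_def card_gt_0_iff)

lemma ncomps_eq_1_iff:
  assumes "finite V" "V \<noteq> {}"
  shows "ncomps V X = 1 \<longleftrightarrow> (\<forall>u\<in>V. \<forall>v\<in>V. conn X u v)"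
proof
  assume "ncomps V X = 1"
  then obtain C where "comp_of V X ` V = {C}" unfolding ncomps_def by (meson card_1_singletonE)
  then show "\<forall>u\<in>V. \<forall>v\<in>V. conn X u v" by (metis comp_of_eq_iff imageI singletonD)
next
  assume *: "\<forall>u\<in>V. \<forall>v\<in>V. conn X u v"
  obtain w where w: "w \<in> V" using assms by blast
  have "comp_of V X u = comp_of V X w" if "u \<in> V" for u
    using * w that by (simp add: comp_of_eq_iff)
  then have "comp_of V X ` V = {comp_of V X w}" using w by blast
  then show "ncomps V X = 1" by (simp add: ncomps_def)
qed

lemma connected_graph_iff_ncomps:
  assumes "finite V"
  shows "connected_graph (V, E) \<longleftrightarrow> V \<noteq> {} \<and> ncomps V (set_mset E) = 1"
  unfolding connected_graph_def reach_eq_conn verts_def edges_def fst_conv snd_conv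
  using ncomps_eq_1_iff[OF assms, of "set_mset E"] by blast

text \<open>The components of \<open>a\<close> and \<open>b\<close> merge and the others, collected
  in \<open>?R\<close>, stay: |R| + 2 components become |R| + 1.\<close>

lemma ncomps_insert:
  assumes "finite V" "a \<in> V" "b \<in> V" "\<not> conn X a b"
  shows "ncomps V (insert {a, b} X) + 1 = ncomps V X"
proof -
  let ?Y = "insert {a, b} X" and ?A = "comp_of V X a" and ?B = "comp_of V X b"
  let ?Q = "comp_of V X ` V" and ?R = "comp_of V X ` V - {comp_of V X a, comp_of V X b}"
  have AB: "comp_of V ?Y u = ?A \<union> ?B" if "conn X u a \<or> conn X u b" for u
    using that unfolding comp_of_def conn_insert by (auto intro: conn_trans conn_sym)
  have other: "comp_of V ?Y u = comp_of V X u" if "\<not> (conn X u a \<or> conn X u b)" for u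
    using that unfolding comp_of_def conn_insert by auto
  have "comp_of V ?Y ` V = insert (?A \<union> ?B) ?R"
  proof (intro equalityI subsetI)
    fix C assume "C \<in> comp_of V ?Y ` V"
    then obtain u where u: "u \<in> V" "C = comp_of V ?Y u" by blast
    show "C \<in> insert (?A \<union> ?B) ?R"
    proof (cases "conn X u a \<or> conn X u b")
      case True
      then show ?thesis using AB[OF True] u by simp
    next
      case False
      then have "comp_of V X u \<noteq> ?A" "comp_of V X u \<noteq> ?B"
        using comp_of_eq_iff[OF u(1) assms(2)] comp_of_eq_iff[OF u(1) assms(3)] by blast+
      then show ?thesis using other[OF False] u by simp
    qed
  next
    fix C assume C: "C \<in> insert (?A \<union> ?B) ?R"
    show "C \<in> comp_of V ?Y ` V"
    proof (cases "C = ?A \<union> ?B")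
      case True
      then show ?thesis using AB[of a] assms(2) by (metis conn_refl imageI)
    next
      case False
      then obtain u where u: "u \<in> V" "C = comp_of V X u" "C \<noteq> ?A" "C \<noteq> ?B" using C by auto
      then have "C = comp_of V ?Y u"
        using other[of u] comp_of_eq_iff[OF u(1) assms(2)] comp_of_eq_iff[OF u(1) assms(3)] by metis
      then show ?thesis using u by blast
    qed
  qed
  moreover have "?A \<union> ?B \<notin> ?R"
  proof
    assume "?A \<union> ?B \<in> ?R"
    then obtain u where u: "u \<in> V" "?A \<union> ?B = comp_of V X u" "comp_of V X u \<noteq> ?A" by auto
    have "a \<in> ?A \<union> ?B" using assms(2) by (simp add: comp_of_def)
    then have "conn X u a" unfolding u(2) by (simp add: comp_of_def)
    then show False using u comp_of_eq_iff[OF u(1) assms(2)] by blast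
  qed
  ultimately have "ncomps V ?Y = Suc (card ?R)"
    using assms(1) by (simp add: ncomps_def)
  moreover have "card ?R + 2 = ncomps V X"
  proof -
    have "?A \<noteq> ?B" using comp_of_eq_iff[OF assms(2,3)] assms(4) by blast
    then have "card {?A, ?B} = 2" by simp
    moreover have sub: "{?A, ?B} \<subseteq> ?Q" using assms by blast
    ultimately show ?thesis unfolding ncomps_def
      using card_Diff_subset[OF _ sub] card_mono[OF _ sub] assms(1) by simp
  qed
  ultimately show ?thesis by simp
qed

lemma ncomps_insert_conn:
  assumes "conn X a b"
  shows "ncomps V (insert {a, b} X) = ncomps V X"
proof (rule ncomps_cong)
  fix u v
  have "conn X b a" using assms by (rule conn_sym)
  then show "conn (insert {a, b} X) u v \<longleftrightarrow> conn X u v"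
    unfolding conn_insert using assms conn_trans[of X u] by blast
qed

definition edges_on :: "'a set \<Rightarrow> 'a set set" where
  "edges_on V = {e. e \<subseteq> V \<and> card e = 2}"

lemma edges_onE:
  assumes "e \<in> edges_on V"
  obtains a b where "e = {a, b}" "a \<in> V" "b \<in> V" "a \<noteq> b"
  using assms unfolding edges_on_def by (auto simp: card_2_iff)

lemma edges_onI: "\<lbrakk>a \<in> V; b \<in> V; a \<noteq> b\<rbrakk> \<Longrightarrow> {a, b} \<in> edges_on V"
  by (simp add: edges_on_def)

lemma edges_on_mono: "V \<subseteq> W \<Longrightarrow> edges_on V \<subseteq> edges_on W"
  unfolding edges_on_def by blast

lemma finite_edges_on: "finite V \<Longrightarrow> finite (edges_on V)"
  by (rule finite_subset[of _ "Pow V"]) (auto simp: edges_on_def)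

text \<open>Each edge merges at most one pair of components. Charging parallel copies separately
  only weakens the bound and fits the later counts over multisets.\<close>

lemma ncomps_Un_mset:
  assumes "finite V" "set_mset D \<subseteq> edges_on V"
  shows "ncomps V X \<le> ncomps V (set_mset D \<union> X) + size D"
  using assms(2)
proof (induction D)
  case (add e D)
  then obtain a b where e: "e = {a, b}" "a \<in> V" "b \<in> V" by (auto elim: edges_onE)
  have "ncomps V (set_mset D \<union> X) \<le> ncomps V (insert e (set_mset D \<union> X)) + 1"
    unfolding e(1) using ncomps_insert[OF assms(1) e(2,3)] ncomps_insert_conn
    by (metis le_add1 order_refl)
  then show ?case using add by simp
qed simp

text \<open>The rank formula for forests: when a forest is built edge by edge, independence makes
  every new edge join two different components.\<close>

lemma card_indep:
  assumes "finite V" "F \<subseteq> edges_on V" "graphic.indep F"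
  shows "card F + ncomps V F = card V"
proof -
  have "finite F" using finite_subset[OF assms(2) finite_edges_on[OF assms(1)]] .
  then show ?thesis using assms(2,3)
  proof (induction F)
    case (insert e F)
    obtain a b where e: "e = {a, b}" "a \<in> V" "b \<in> V" using insert.prems by (auto elim: edges_onE)
    have "e \<notin> edge_cl F" using insert.prems(2) insert.hyps(2) unfolding graphic.indep_def by auto
    then have "\<not> conn F a b" unfolding e(1) pair_mem_edge_cl .
    from ncomps_insert[OF assms(1) e(2,3) this] show ?case
      using insert.IH insert.prems insert.hyps graphic.indep_mono[OF insert.prems(2), of F]
      unfolding e(1) by (simp add: subset_insertI)
  qed simp
qed

section \<open>Packing and covering by spanning trees\<close>

definition connected_on :: "'a set \<Rightarrow> 'a set multiset \<Rightarrow> bool" where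
  "connected_on V T \<longleftrightarrow> set_mset T \<subseteq> edges_on V \<and> ncomps V (set_mset T) = 1"

definition tree_on :: "'a set \<Rightarrow> 'a set multiset \<Rightarrow> bool" where
  "tree_on V T \<longleftrightarrow> connected_on V T \<and> size T = card V - 1"

lemma tree_on_mset_set:
  assumes "finite V" "V \<noteq> {}" "B \<subseteq> edges_on V" "graphic.indep B" "ncomps V B = 1"
  shows "tree_on V (mset_set B)"
  using finite_subset[OF assms(3) finite_edges_on[OF assms(1)]] card_indep[OF assms(1,3,4)] assms(3,5)
  by (simp add: tree_on_def connected_on_def)

text \<open>A spanning subset has the same components as the whole; together with
  \<open>card_indep\<close> this reads ranks off component counts.\<close>

lemma ncomps_cl:
  assumes "B \<subseteq> X" "X \<subseteq> edge_cl B"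
  shows "ncomps V B = ncomps V X"
proof (rule ncomps_cong)
  fix u v
  show "conn B u v \<longleftrightarrow> conn X u v"
  proof
    assume "conn X u v"
    then have "conn (edge_cl B) u v" by (rule conn_mono) (rule assms(2))
    then show "conn B u v" by (simp add: conn_edge_cl)
  qed (rule conn_mono[OF _ assms(1)])
qed

text \<open>The tree is a basis of the complete graph on \<open>V\<close>, so it may use pairs that
  are not edges of the graph at hand. This turns covering forests into trees.\<close>

lemma extend_to_tree:
  assumes "finite V" "V \<noteq> {}" "F \<subseteq> edges_on V" "graphic.indep F"
  obtains B where "F \<subseteq> B" "finite B" "tree_on V (mset_set B)"
proof -
  obtain B where B: "F \<subseteq> B" "B \<subseteq> edges_on V" "graphic.indep B" "edges_on V \<subseteq> edge_cl B"
    using graphic.basis_extension[OF finite_edges_on[OF assms(1)] assms(4,3)] .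
  have "conn B u v" if "u \<in> V" "v \<in> V" for u v
    using B(4) edges_onI[OF that] pair_mem_edge_cl[of u v B] by (cases "u = v") auto
  then have "ncomps V B = 1" using ncomps_eq_1_iff[OF assms(1,2)] by blast
  then show ?thesis
    using that B(1) finite_subset[OF B(2) finite_edges_on[OF assms(1)]]
      tree_on_mset_set[OF assms(1,2) B(2,3)] by blast
qed

lemma packing_edges_on:
  assumes "graphic.packing k E F" "set_mset E \<subseteq> edges_on V" "i < k"
  shows "finite (F i)" "graphic.indep (F i)" "F i \<subseteq> set_mset E" "F i \<subseteq> edges_on V"
proof -
  show F: "finite (F i)" "graphic.indep (F i)" using assms unfolding graphic.packing_def by auto
  have "set_mset (graphic.covered k F) \<subseteq> set_mset E"
    using assms(1) unfolding graphic.packing_def by (blast intro: set_mset_mono[THEN subsetD])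
  moreover have "F i \<subseteq> set_mset (graphic.covered k F)"
  proof
    fix e assume "e \<in> F i"
    then have "e \<in># mset_set (F i)" using F by simp
    then show "e \<in># graphic.covered k F"
      unfolding graphic.covered_def using assms(3) by (subst set_mset_sum) auto
  qed
  ultimately show "F i \<subseteq> set_mset E" by blast
  then show "F i \<subseteq> edges_on V" using assms(2) by blast
qed

lemma size_filter_partition:
  "size M = size (filter_mset P M) + size (filter_mset (\<lambda>x. \<not> P x) M)"
  by (metis multiset_partition size_union)

lemma filter_mset_sum:
  "filter_mset P (\<Sum>i\<in>S. f i) = (\<Sum>i\<in>S. filter_mset P (f i))"
  by (induction S rule: infinite_finite_induct) simp_all

lemma sum_subset_mset:
  fixes f g :: "'i \<Rightarrow> 'e multiset"
  assumes "\<And>i. i \<in> S \<Longrightarrow> f i \<subseteq># g i"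
  shows "sum f S \<subseteq># sum g S"
  using assms by (induction S rule: infinite_finite_induct) (simp_all add: subset_mset.add_mono)

text \<open>\<open>A\<close> witnesses optimality: outside \<open>A\<close> every edge is used, and inside \<open>A\<close> every forest of
  the packing has full rank.\<close>
lemma forest_packing:
  assumes "finite V" "set_mset E \<subseteq> edges_on V"
  obtains F A where "graphic.packing k E F"
    "size (filter_mset (\<lambda>e. e \<notin> A) E) +
       k * (card V - ncomps V (set_mset (filter_mset (\<lambda>e. e \<in> A) E))) \<le> size (graphic.covered k F)"
proof -
  obtain F A where F: "graphic.packing k E F" and A: "\<And>i. i < k \<Longrightarrow> A \<subseteq> edge_cl (F i \<inter> A)"
    and out: "filter_mset (\<lambda>e. e \<notin> A) E \<subseteq># graphic.covered k F"
    using graphic.matroid_union[of k E] by blast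
  let ?EA = "set_mset (filter_mset (\<lambda>e. e \<in> A) E)"
  note Fi = packing_edges_on[OF F assms(2)]
  \<comment> \<open>\<open>F i \<inter> A\<close> is a basis of the edges of \<open>E\<close> lying
    in \<open>A\<close>, so its size is the rank of that edge set.\<close>
  have rank: "card (F i \<inter> A) = card V - ncomps V ?EA" if i: "i < k" for i
  proof -
    have "F i \<inter> A \<subseteq> ?EA" using Fi(3)[OF i] by auto
    moreover have "?EA \<subseteq> edge_cl (F i \<inter> A)" using A[OF i] by auto
    ultimately have "ncomps V (F i \<inter> A) = ncomps V ?EA" by (rule ncomps_cl)
    moreover have "card (F i \<inter> A) + ncomps V (F i \<inter> A) = card V"
      using Fi[OF i] graphic.indep_mono[of "F i" "F i \<inter> A"] by (intro card_indep[OF assms(1)]) auto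
    ultimately show ?thesis by simp
  qed
  let ?C = "graphic.covered k F"
  have "filter_mset (\<lambda>e. e \<in> A) ?C = (\<Sum>i<k. mset_set (F i \<inter> A))"
    unfolding graphic.covered_def filter_mset_sum
    using Fi(1) by (intro sum.cong) (simp_all add: Int_def)
  then have "size (filter_mset (\<lambda>e. e \<in> A) ?C) = k * (card V - ncomps V ?EA)"
    by (simp add: rank)
  moreover have "size (filter_mset (\<lambda>e. e \<notin> A) E) \<le> size (filter_mset (\<lambda>e. e \<notin> A) ?C)"
    using size_mset_mono[OF multiset_filter_mono[OF out, of "\<lambda>e. e \<notin> A"]]
    by (simp add: filter_filter_mset)
  moreover have "size ?C = size (filter_mset (\<lambda>e. e \<in> A) ?C) + size (filter_mset (\<lambda>e. e \<notin> A) ?C)"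
    by (rule size_filter_partition)
  ultimately show ?thesis using that[OF F, of A] by simp
qed

lemma sum_list_covered:
  "sum_list (map (\<lambda>i. mset_set (F i)) [0..<k]) = graphic.covered k F"
  unfolding graphic.covered_def by (simp add: interv_sum_list_conv_sum_set_nat lessThan_atLeast0)

text \<open>Applied to the edges outside \<open>A\<close>, the cut condition forces the forests to
  have k(|V| - 1) edges in total. No forest exceeds |V| - 1, so each is a spanning tree.\<close>

theorem tree_packing:
  assumes "finite V" "V \<noteq> {}" "set_mset E \<subseteq> edges_on V"
    and cut: "\<And>X. X \<subseteq># E \<Longrightarrow> k * (ncomps V (set_mset (E - X)) - 1) \<le> size X"
  obtains Ts where "length Ts = k" "\<forall>T\<in>set Ts. tree_on V T" "sum_list Ts \<subseteq># E"
proof -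
  obtain F A where F: "graphic.packing k E F" and
    sz: "size (filter_mset (\<lambda>e. e \<notin> A) E) +
       k * (card V - ncomps V (set_mset (filter_mset (\<lambda>e. e \<in> A) E))) \<le> size (graphic.covered k F)"
    by (rule forest_packing[OF assms(1,3)])
  note Fi = packing_edges_on[OF F assms(3)]
  let ?c = "ncomps V (set_mset (filter_mset (\<lambda>e. e \<in> A) E))"
  have "E - filter_mset (\<lambda>e. e \<notin> A) E = filter_mset (\<lambda>e. e \<in> A) E"
    by (rule multiset_eqI) simp
  then have "k * (?c - 1) \<le> size (filter_mset (\<lambda>e. e \<notin> A) E)"
    using cut[of "filter_mset (\<lambda>e. e \<notin> A) E"] by simp
  moreover have "0 < ?c" "?c \<le> card V"
    using ncomps_pos[OF assms(1,2)] ncomps_le_card[OF assms(1)] by auto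
  then have "k * (card V - 1) = k * (?c - 1) + k * (card V - ?c)"
    unfolding distrib_left[symmetric] by simp
  ultimately have "k * (card V - 1) \<le> size (graphic.covered k F)" using sz by simp
  then have total: "(\<Sum>i<k. card V - 1) \<le> (\<Sum>i<k. card (F i))"
    by (simp add: graphic.covered_def)
  have rank: "card (F i) + ncomps V (F i) = card V" if "i < k" for i
    using card_indep[OF assms(1) Fi(4,2)] that by blast
  have le: "card (F i) \<le> card V - 1" if "i < k" for i
    using rank[OF that] ncomps_pos[OF assms(1,2), of "F i"] by simp
  have tree: "tree_on V (mset_set (F i))" if i: "i < k" for i
  proof -
    have "card (F i) = card V - 1"
    proof (rule ccontr)
      assume "card (F i) \<noteq> card V - 1"
      then have "card (F i) < card V - 1" using le[OF i] by simp
      then have "(\<Sum>i<k. card (F i)) < (\<Sum>i<k. card V - 1)"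
        using le i by (intro sum_strict_mono_ex1) auto
      then show False using total by simp
    qed
    then have "ncomps V (F i) = 1"
      using rank[OF i] ncomps_pos[OF assms(1,2), of "F i"] by simp
    then show ?thesis using tree_on_mset_set[OF assms(1,2) Fi(4,2)] i by blast
  qed
  show ?thesis
  proof (rule that)
    show "sum_list (map (\<lambda>i. mset_set (F i)) [0..<k]) \<subseteq># E"
      using F unfolding sum_list_covered graphic.packing_def by blast
  qed (use tree in auto)
qed

text \<open>Applied to the edges inside \<open>A\<close>, sparsity says that they are no more than
  the forests hold there, so the forests cover \<open>E\<close>. Enlarging them to trees adds new
  edges, hence only an inclusion in the conclusion.\<close>

theorem tree_covering:
  assumes "finite V" "V \<noteq> {}" "set_mset E \<subseteq> edges_on V"
    and sparse: "\<And>D. D \<subseteq># E \<Longrightarrow> size D \<le> k * (card V - ncomps V (set_mset D))"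
  obtains Ts where "length Ts = k" "\<forall>T\<in>set Ts. tree_on V T" "E \<subseteq># sum_list Ts"
proof -
  obtain F A where F: "graphic.packing k E F" and
    sz: "size (filter_mset (\<lambda>e. e \<notin> A) E) +
       k * (card V - ncomps V (set_mset (filter_mset (\<lambda>e. e \<in> A) E))) \<le> size (graphic.covered k F)"
    by (rule forest_packing[OF assms(1,3)])
  note Fi = packing_edges_on[OF F assms(3)]
  have sub: "graphic.covered k F \<subseteq># E" using F unfolding graphic.packing_def by blast
  have "size E = size (filter_mset (\<lambda>e. e \<in> A) E) + size (filter_mset (\<lambda>e. e \<notin> A) E)"
    by (rule size_filter_partition)
  then have "size E \<le> size (graphic.covered k F)"
    using sz sparse[of "filter_mset (\<lambda>e. e \<in> A) E"] by simp
  then have E: "graphic.covered k F = E"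
    using sub mset_subset_size[of "graphic.covered k F" E] subset_mset.le_neq_trans by fastforce
  have "\<exists>B. F i \<subseteq> B \<and> finite B \<and> tree_on V (mset_set B)" if "i < k" for i
    using extend_to_tree[OF assms(1,2) Fi(4,2)[OF that]] by blast
  then obtain B where B: "\<And>i. i < k \<Longrightarrow> F i \<subseteq> B i \<and> finite (B i) \<and> tree_on V (mset_set (B i))"
    by metis
  have "graphic.covered k F \<subseteq># graphic.covered k B"
    unfolding graphic.covered_def using B
    by (intro sum_subset_mset) (simp add: subset_imp_msubset_mset_set)
  then show ?thesis
    using that[of "map (\<lambda>i. mset_set (B i)) [0..<k]"] B unfolding sum_list_covered E by auto
qed

section \<open>Edge counts of trees against component counts\<close>

lemma ncomps_le_crossing:
  assumes "finite V" "connected_on V T" "\<And>e. \<lbrakk>e \<in># T; \<not> P e\<rbrakk> \<Longrightarrow> e \<in> edge_cl Y"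
  shows "ncomps V Y \<le> 1 + size (filter_mset P T)"
proof -
  let ?Q = "filter_mset (\<lambda>e. \<not> P e) T"
  have T: "set_mset T \<subseteq> edges_on V" "ncomps V (set_mset T) = 1"
    using assms(2) by (auto simp: connected_on_def)
  \<comment> \<open>The edges of \<open>T\<close> outside \<open>P\<close> are spanned by
    \<open>Y\<close>, so \<open>Y\<close> has no more components than they do; restoring each
    \<open>P\<close>-edge to them loses at most one component.\<close>
  have "ncomps V Y \<le> ncomps V (set_mset ?Q)"
  proof (rule ncomps_antimono[OF assms(1)])
    fix u v assume "conn (set_mset ?Q) u v"
    then have "conn (edge_cl Y) u v" by (rule conn_mono) (use assms(3) in auto)
    then show "conn Y u v" by (simp add: conn_edge_cl)
  qed
  also have "\<dots> \<le> ncomps V (set_mset (filter_mset P T) \<union> set_mset ?Q) + size (filter_mset P T)"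
    by (rule ncomps_Un_mset[OF assms(1)]) (use T(1) in auto)
  also have "set_mset (filter_mset P T) \<union> set_mset ?Q = set_mset T" by auto
  finally show ?thesis using T(2) by simp
qed

lemma size_filter_sum_list_ge:
  assumes "\<And>T. T \<in> set Ts \<Longrightarrow> c \<le> size (filter_mset P T)"
  shows "length Ts * c \<le> size (filter_mset P (sum_list Ts))"
  using assms by (induction Ts) (simp_all add: add_mono)

lemma size_filter_sum_list_le:
  assumes "\<And>T. T \<in> set Ts \<Longrightarrow> size (filter_mset P T) \<le> c"
  shows "size (filter_mset P (sum_list Ts)) \<le> length Ts * c"
  using assms by (induction Ts) (simp_all add: add_mono)

text \<open>After contracting the components of \<open>E - X\<close>, every connected spanning graph
  needs at least c - 1 edges between them. Disjointness makes these contributions add up inside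
  \<open>X\<close>.\<close>

lemma packing_cut:
  assumes "finite V" "\<And>T. T \<in> set Ts \<Longrightarrow> connected_on V T" "sum_list Ts \<subseteq># E"
  shows "length Ts * (ncomps V (set_mset (E - X)) - 1) \<le> size X"
proof -
  let ?P = "\<lambda>e. e \<notin> edge_cl (set_mset (E - X))"
  have "length Ts * (ncomps V (set_mset (E - X)) - 1) \<le> size (filter_mset ?P (sum_list Ts))"
  proof (rule size_filter_sum_list_ge)
    fix T assume "T \<in> set Ts"
    from ncomps_le_crossing[OF assms(1) assms(2)[OF this], of ?P "set_mset (E - X)"]
    show "ncomps V (set_mset (E - X)) - 1 \<le> size (filter_mset ?P T)" by simp
  qed
  \<comment> \<open>An edge between different components of \<open>E - X\<close> has no copy there,
    so \<open>X\<close> contains all its copies in \<open>E\<close>.\<close>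
  also have "filter_mset ?P (sum_list Ts) \<subseteq># X"
  proof (rule mset_subset_eqI)
    fix e
    have "count (sum_list Ts) e \<le> count E e" using assms(3) by (rule mset_subset_eq_count)
    moreover have "count E e \<le> count X e" if "e \<notin># E - X"
      using that by (simp add: count_eq_zero_iff[symmetric])
    moreover have "e \<notin># E - X" if "?P e" using that by (auto simp: edge_cl_def)
    ultimately show "count (filter_mset ?P (sum_list Ts)) e \<le> count X e" by fastforce
  qed
  then have "size (filter_mset ?P (sum_list Ts)) \<le> size X" by (rule size_mset_mono)
  finally show ?thesis .
qed

text \<open>A part of a tree is a forest; in this counted form repeated edges are excluded too. The
  count is made on \<open>V\<close> and moved to \<open>W\<close> through a basis \<open>B\<close>
  of \<open>D\<close>: both |V| and |W|, less their numbers of components, equal |B|.\<close>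

lemma tree_subset_size:
  assumes "finite V" "tree_on V T" "V \<noteq> {}" "D \<subseteq># T" "W \<subseteq> V" "set_mset D \<subseteq> edges_on W"
  shows "size D \<le> card W - ncomps W (set_mset D)"
proof -
  have W: "finite W" using assms(1,5) finite_subset by blast
  have T: "set_mset T \<subseteq> edges_on V" "ncomps V (set_mset T) = 1" "size T = card V - 1"
    using assms(2) by (auto simp: tree_on_def connected_on_def)
  have DV: "set_mset D \<subseteq> edges_on V" using edges_on_mono[OF assms(5)] assms(6) by blast
  have TD: "T = T - D + D" using assms(4) by simp
  have "ncomps V (set_mset D) \<le> ncomps V (set_mset (T - D) \<union> set_mset D) + size (T - D)"
    by (rule ncomps_Un_mset[OF assms(1)]) (use T(1) in \<open>auto dest: in_diffD\<close>)
  also have "set_mset (T - D) \<union> set_mset D = set_mset T" by (subst (2) TD) (simp add: Un_commute)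
  finally have "ncomps V (set_mset D) \<le> 1 + size (T - D)" using T(2) by simp
  moreover have "size T = size (T - D) + size D" by (subst TD) simp
  moreover have "0 < card V" using assms(1,3) by (simp add: card_gt_0_iff)
  ultimately have V: "size D + ncomps V (set_mset D) \<le> card V" using T(3) by simp
  obtain B where "{} \<subseteq> B" and B: "B \<subseteq> set_mset D" "graphic.indep B" "set_mset D \<subseteq> edge_cl B"
    by (rule graphic.basis_extension[OF finite_set_mset graphic.indep_empty empty_subsetI])
  have "card B + ncomps V B = card V" "card B + ncomps W B = card W"
    using card_indep[OF assms(1) _ B(2)] card_indep[OF W _ B(2)] B(1) DV assms(6) by auto
  then show ?thesis using V ncomps_cl[OF B(1,3), of V] ncomps_cl[OF B(1,3), of W] by simp
qed

section \<open>Edge connectivity, strength and density\<close>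

lemma verts_Pair [simp]: "verts (V, E) = V" and edges_Pair [simp]: "edges (V, E) = E"
  by (simp_all add: verts_def edges_def)

lemma wf_graph_iff: "wf_graph G \<longleftrightarrow> finite (verts G) \<and> set_mset (edges G) \<subseteq> edges_on (verts G)"
  by (auto simp: wf_graph_def edges_on_def)

lemma connected_graph_iff:
  "finite (verts G) \<Longrightarrow>
     connected_graph G \<longleftrightarrow> verts G \<noteq> {} \<and> ncomps (verts G) (set_mset (edges G)) = 1"
  using connected_graph_iff_ncomps[of "verts G" "edges G"] by (simp add: verts_def edges_def)

lemma finite_submultisets: "finite {X. X \<subseteq># E}"
proof (rule finite_subset)
  show "{X. X \<subseteq># E} \<subseteq> (\<Union>n\<le>size E. multisets_of_size (set_mset E) n)"
    by (auto simp: multisets_of_size_def size_mset_mono dest: mset_subset_eqD)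
qed auto

lemma ex_submultiset_of_size:
  assumes "k \<le> size M"
  obtains K where "K \<subseteq># M" "size K = k"
proof -
  obtain xs where xs: "M = mset xs" by (metis ex_mset)
  have "mset (take k xs) \<subseteq># mset (take k xs @ drop k xs)" by (simp only: mset_append mset_subset_eq_add_left)
  then show ?thesis using that[of "mset (take k xs)"] assms xs by simp
qed

text \<open>Clears denominators. Deletions that leave the graph connected give no quotient, and for
  them c - 1 = 0 makes the inequality trivial. Two vertices guarantee a quotient (delete
  everything), so \<open>Min\<close> ranges over a nonempty set.\<close>

lemma eta_ge_iff:
  assumes "finite V" "2 \<le> card V" "ncomps V (set_mset E) = 1"
  shows "real k \<le> eta (V, E) \<longleftrightarrow>
    (\<forall>X. X \<subseteq># E \<longrightarrow> k * (ncomps V (set_mset (E - X)) - 1) \<le> size X)"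
proof -
  let ?c = "\<lambda>X. ncomps V (set_mset (E - X))"
  let ?S = "{real (size X) / (real (?c X) - 1) |X. X \<subseteq># E \<and> real (?c X) - 1 \<noteq> 0}"
  have eta: "eta (V, E) = Min ?S"
    using assms(3) by (simp add: eta_def ncomp_eq_ncomps del_edges_def)
  have "?S = (\<lambda>X. real (size X) / (real (?c X) - 1)) ` {X \<in> {X. X \<subseteq># E}. real (?c X) - 1 \<noteq> 0}"
    by auto
  then have fin: "finite ?S" using finite_submultisets[of E] by simp
  have "real (?c E) - 1 \<noteq> 0" using assms(2) by simp
  then have ne: "?S \<noteq> {}" by blast
  have V: "V \<noteq> {}" using assms(2) by auto
  have "real k \<le> real (size X) / (real (?c X) - 1) \<longleftrightarrow> k * (?c X - 1) \<le> size X"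
    if "real (?c X) - 1 \<noteq> 0" for X
  proof -
    have "1 < ?c X" using ncomps_pos[OF assms(1) V, of "set_mset (E - X)"] that by linarith
    then have "real k \<le> real (size X) / (real (?c X) - 1) \<longleftrightarrow> real (k * (?c X - 1)) \<le> real (size X)"
      by (simp add: pos_le_divide_eq of_nat_diff)
    then show ?thesis by (simp only: of_nat_le_iff)
  qed
  moreover have "k * (?c X - 1) \<le> size X" if "\<not> real (?c X) - 1 \<noteq> 0" for X
    using that by simp
  ultimately show ?thesis unfolding eta Min_ge_iff[OF fin ne] by blast
qed

text \<open>A subgraph with zero denominator has no edge, since any edge merges two vertices, and so
  satisfies the inequality trivially. An edge in \<open>G\<close> makes the set under
  \<open>Max\<close> nonempty.\<close>

lemma gamma_le_iff:
  assumes "wf_graph G" "verts G \<noteq> {}" "edges G \<noteq> {#}"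
  shows "gamma G \<le> real k \<longleftrightarrow>
    (\<forall>W D. W \<subseteq> verts G \<and> D \<subseteq># edges G \<and> set_mset D \<subseteq> edges_on W \<longrightarrow>
       size D \<le> k * (card W - ncomps W (set_mset D)))"
    (is "_ \<longleftrightarrow> (\<forall>W D. ?sub W D \<longrightarrow> ?le W D)")
proof -
  have G: "finite (verts G)" "set_mset (edges G) \<subseteq> edges_on (verts G)"
    using assms(1) by (auto simp: wf_graph_iff)
  have sub: "subgraph (W, D) G \<longleftrightarrow> ?sub W D" for W D
    using G(2) unfolding subgraph_def edges_on_def
    by (auto dest: mset_subset_eqD)
  let ?d = "\<lambda>W D. real (card W) - real (ncomps W (set_mset D))"
  let ?S = "{real (size D) / ?d W D |W D. ?sub W D \<and> ?d W D \<noteq> 0}"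
  have gamma: "gamma G = Max ?S"
    unfolding gamma_def dens_def ncomp_eq_ncomps split_paired_Ex sub[symmetric] by simp
  have "?S \<subseteq> (\<lambda>(W, D). real (size D) / ?d W D) ` (Pow (verts G) \<times> {X. X \<subseteq># edges G})"
    by auto
  then have fin: "finite ?S"
    by (rule finite_subset) (simp add: finite_submultisets G(1))
  have empty: "D = {#}" if "?sub W D" "?d W D = 0" for W D
  proof (rule ccontr)
    assume "D \<noteq> {#}"
    then obtain e where e: "e \<in># D" by blast
    then obtain a b where ab: "e = {a, b}" "a \<in> W" "b \<in> W" "a \<noteq> b"
      using \<open>?sub W D\<close> edges_onE by blast
    have W: "finite W" using that(1) G(1) finite_subset by blast
    have "ncomps W (set_mset D) \<le> ncomps W {{a, b}}"
      by (rule ncomps_antimono[OF W]) (rule conn_mono, use e ab in auto)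
    moreover have "\<not> conn {} a b" using conn_stays[of "{}" a b "{a}"] ab(4) by auto
    then have "ncomps W {{a, b}} + 1 = card W" using ncomps_insert[OF W ab(2,3)] by simp
    ultimately show False using that(2) by simp
  qed
  have "?sub (verts G) (edges G)" using G by simp
  then have ne: "?S \<noteq> {}" using empty[of "verts G" "edges G"] assms(3) by blast
  have "real (size D) / ?d W D \<le> real k \<longleftrightarrow> ?le W D" if "?sub W D" "?d W D \<noteq> 0" for W D
  proof -
    have "ncomps W (set_mset D) \<le> card W"
      using that(1) G(1) finite_subset by (intro ncomps_le_card) blast
    then have less: "ncomps W (set_mset D) < card W" using that(2) by linarith
    then have "real (size D) / ?d W D \<le> real k \<longleftrightarrow>
        real (size D) \<le> real (k * (card W - ncomps W (set_mset D)))"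
      by (simp add: pos_divide_le_eq of_nat_diff)
    then show ?thesis by (simp only: of_nat_le_iff)
  qed
  moreover have "?le W D" if "?sub W D" "\<not> ?d W D \<noteq> 0" for W D
    using empty[OF that(1)] that(2) by simp
  ultimately show ?thesis unfolding gamma Max_le_iff[OF fin ne] by blast
qed

lemma edge_conn_le:
  assumes "X \<subseteq># edges G" "\<not> connected_graph (del_edges G X)"
  shows "edge_conn G \<le> size X"
  unfolding edge_conn_def using assms by (intro wellorder_Inf_le1) blast

lemma edge_conn_cut:
  assumes "finite (verts G)" "2 \<le> card (verts G)"
  obtains X where "X \<subseteq># edges G" "\<not> connected_graph (del_edges G X)" "size X = edge_conn G"
proof -
  let ?S = "{size X |X. X \<subseteq># edges G \<and> \<not> connected_graph (del_edges G X)}"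
  have "\<not> connected_graph (del_edges G (edges G))"
    using assms by (simp add: connected_graph_iff del_edges_def)
  then have "?S \<noteq> {}" by blast
  from Inf_nat_def1[OF this] have "edge_conn G \<in> ?S" unfolding edge_conn_def .
  then show ?thesis using that by auto
qed

lemma disconnected_cut:
  assumes "finite V" "V \<noteq> {}" "\<not> connected_graph (V, D)"
  obtains V1 V2 where "V1 \<union> V2 = V" "V1 \<inter> V2 = {}" "V1 \<noteq> {}" "V2 \<noteq> {}"
    "\<And>e. e \<in># D \<Longrightarrow> e \<in> edges_on V \<Longrightarrow> e \<inter> V1 = {} \<or> e \<inter> V2 = {}"
proof -
  obtain u v where uv: "u \<in> V" "v \<in> V" "\<not> conn (set_mset D) u v"
    using assms by (auto simp: connected_graph_def reach_eq_conn)
  define V1 where "V1 = {w \<in> V. conn (set_mset D) u w}"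
  show ?thesis
  proof (rule that[of V1 "V - V1"])
    show "V1 \<noteq> {}" "V - V1 \<noteq> {}" using uv by (auto simp: V1_def)
    fix e assume e: "e \<in># D" "e \<in> edges_on V"
    obtain a b where ab: "e = {a, b}" "a \<in> V" "b \<in> V" using e(2) by (auto elim: edges_onE)
    have "conn (set_mset D) a b" using e(1) ab(1) by (simp add: conn_edge)
    then have "conn (set_mset D) u a \<longleftrightarrow> conn (set_mset D) u b" by (meson conn_sym conn_trans)
    then show "e \<inter> V1 = {} \<or> e \<inter> (V - V1) = {}" using ab by (auto simp: V1_def)
  qed (auto simp: V1_def)
qed

lemma connected_on_crossing:
  assumes "finite V" "connected_on V T" "V1 \<union> V2 = V" "V1 \<inter> V2 = {}" "V1 \<noteq> {}" "V2 \<noteq> {}"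
  obtains e where "e \<in># T" "e \<inter> V1 \<noteq> {}" "e \<inter> V2 \<noteq> {}"
proof -
  obtain a b where ab: "a \<in> V1" "b \<in> V2" using assms by blast
  have T: "set_mset T \<subseteq> edges_on V" "conn (set_mset T) a b"
    using assms ab ncomps_eq_1_iff[of V "set_mset T"] by (auto simp: connected_on_def)
  have "\<exists>x y. {x, y} \<in># T \<and> x \<in> V1 \<and> y \<notin> V1"
    using conn_stays[OF T(2) ab(1)] ab(2) assms(4) by blast
  then obtain x y where xy: "{x, y} \<in># T" "x \<in> V1" "y \<notin> V1" by blast
  then have "y \<in> V2" using T(1) assms(3) by (auto simp: edges_on_def)
  then show ?thesis using that[OF xy(1)] xy(2) by blast
qed

section \<open>The packing number and its bound by edge connectivity\<close>

lemma spanning_tree_iff: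
  assumes "wf_graph G" "verts G \<noteq> {}"
  shows "spanning_tree G T \<longleftrightarrow> T \<subseteq># edges G \<and> tree_on (verts G) T"
proof -
  have G: "finite (verts G)" "set_mset (edges G) \<subseteq> edges_on (verts G)"
    using assms(1) by (auto simp: wf_graph_iff)
  have "set_mset T \<subseteq> edges_on (verts G)" if "T \<subseteq># edges G"
    using set_mset_mono[OF that] G(2) by blast
  then show ?thesis
    using connected_graph_iff_ncomps[OF G(1), of T] assms(2)
    by (auto simp: spanning_tree_def tree_on_def connected_on_def)
qed

definition tree_packing_in :: "'a mgraph \<Rightarrow> 'a set multiset list \<Rightarrow> bool" where
  "tree_packing_in G Ts \<longleftrightarrow> (\<forall>T\<in>set Ts. tree_on (verts G) T) \<and> sum_list Ts \<subseteq># edges G"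

lemma tree_pack_eq:
  assumes "wf_graph G" "verts G \<noteq> {}"
  shows "tree_pack G = Sup {length Ts |Ts. tree_packing_in G Ts}"
proof -
  have "(\<forall>T\<in>set Ts. spanning_tree G T) \<and> sum_list Ts \<subseteq># edges G \<longleftrightarrow> tree_packing_in G Ts" for Ts
  proof -
    have "T \<subseteq># sum_list Ts" if "T \<in> set Ts" for T
      using that by (induction Ts) (auto intro: subset_mset.add_increasing)
    then show ?thesis unfolding tree_packing_in_def spanning_tree_iff[OF assms]
      by (meson subset_mset.trans)
  qed
  then show ?thesis by (simp add: tree_pack_def)
qed

lemma tree_packing_size:
  assumes "\<forall>T\<in>set Ts. tree_on V T"
  shows "size (sum_list Ts) = length Ts * (card V - 1)"
  using assms by (induction Ts) (simp_all add: tree_on_def)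

text \<open>On one vertex the tree is empty and can be repeated without bound; from two vertices on
  each tree uses up an edge, so the \<open>Sup\<close> in the packing number is a maximum.\<close>

lemma finite_tree_packings:
  assumes "2 \<le> card (verts G)"
  shows "finite {length Ts |Ts. tree_packing_in G Ts}"
proof (rule finite_subset)
  show "{length Ts |Ts. tree_packing_in G Ts} \<subseteq> {..size (edges G)}"
  proof
    fix l assume "l \<in> {length Ts |Ts. tree_packing_in G Ts}"
    then obtain Ts where l: "l = length Ts" and "tree_packing_in G Ts" by blast
    then have "length Ts * (card (verts G) - 1) \<le> size (edges G)"
      using tree_packing_size[of Ts "verts G"] size_mset_mono[of "sum_list Ts" "edges G"]
      by (simp add: tree_packing_in_def)
    moreover have "length Ts * 1 \<le> length Ts * (card (verts G) - 1)"
      using assms by (intro mult_left_mono) auto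
    ultimately show "l \<in> {..size (edges G)}" unfolding atMost_iff l by linarith
  qed
qed simp

lemma tree_pack_ge:
  assumes "wf_graph G" "2 \<le> card (verts G)" "tree_packing_in G Ts"
  shows "length Ts \<le> tree_pack G"
proof -
  have "verts G \<noteq> {}" using assms(2) by auto
  then show ?thesis unfolding tree_pack_eq[OF assms(1) \<open>verts G \<noteq> {}\<close>]
    using finite_tree_packings[OF assms(2)] assms(3) by (intro cSup_upper) (auto intro: bdd_above_finite)
qed

lemma tree_pack_packing:
  assumes "wf_graph G" "2 \<le> card (verts G)"
  obtains Ts where "tree_packing_in G Ts" "length Ts = tree_pack G"
proof -
  let ?S = "{length Ts |Ts. tree_packing_in G Ts}"
  have "verts G \<noteq> {}" using assms(2) by auto
  moreover have "tree_packing_in G []" by (simp add: tree_packing_in_def)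
  then have "?S \<noteq> {}" by blast
  ultimately have "tree_pack G \<in> ?S"
    unfolding tree_pack_eq[OF assms(1) \<open>verts G \<noteq> {}\<close>]
    using Max_in[OF finite_tree_packings[OF assms(2)]] cSup_eq_Max[OF finite_tree_packings[OF assms(2)]]
    by simp
  then show ?thesis using that by auto
qed

lemma tree_packing_in_cut:
  assumes "finite (verts G)" "tree_packing_in G Ts"
  shows "length Ts * (ncomps (verts G) (set_mset (edges G - X)) - 1) \<le> size X"
  using assms by (intro packing_cut) (auto simp: tree_packing_in_def tree_on_def)

text \<open>A minimum cut leaves at least two components, so every tree of the packing spends an
  edge on it.\<close>

lemma length_le_edge_conn:
  assumes "finite (verts G)" "2 \<le> card (verts G)" "tree_packing_in G Ts"
  shows "length Ts \<le> edge_conn G"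
proof -
  obtain X where X: "X \<subseteq># edges G" "\<not> connected_graph (del_edges G X)" "size X = edge_conn G"
    by (rule edge_conn_cut[OF assms(1,2)])
  have "verts G \<noteq> {}" using assms(2) by auto
  then have "1 \<le> ncomps (verts G) (set_mset (edges G - X)) - 1"
    using X(2) assms(1) ncomps_pos[of "verts G" "set_mset (edges G - X)"]
    by (simp add: connected_graph_iff del_edges_def)
  then have "length Ts * 1 \<le> length Ts * (ncomps (verts G) (set_mset (edges G - X)) - 1)"
    by (rule mult_left_mono) simp
  also have "\<dots> \<le> size X" by (rule tree_packing_in_cut[OF assms(1,3)])
  finally show ?thesis using X(3) by simp
qed

text \<open>A minimum cut of \<open>H\<close>, intersected with the edges of \<open>G\<close>, still
  disconnects \<open>G\<close>.\<close>

lemma edge_conn_mono: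
  assumes "wf_graph H" "2 \<le> card (verts H)" "spanning_subgraph G H"
  shows "edge_conn G \<le> edge_conn H"
proof -
  have H: "finite (verts H)" "verts G = verts H" "edges G \<subseteq># edges H"
    using assms by (auto simp: wf_graph_iff spanning_subgraph_def)
  obtain X where X: "X \<subseteq># edges H" "\<not> connected_graph (del_edges H X)" "size X = edge_conn H"
    by (rule edge_conn_cut[OF H(1) assms(2)])
  have "\<not> connected_graph (del_edges G (edges G \<inter># X))"
  proof
    assume con: "connected_graph (del_edges G (edges G \<inter># X))"
    have "edges G - edges G \<inter># X \<subseteq># edges H - X"
      using H(3) by (auto simp: subseteq_mset_def intro!: diff_le_mono)
    then have "set_mset (edges G - edges G \<inter># X) \<subseteq> set_mset (edges H - X)" by (rule set_mset_mono)
    then have "connected_graph (del_edges H X)"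
      using con unfolding connected_graph_def del_edges_def reach_eq_conn H(2)
      by (auto intro: conn_mono)
    then show False using X(2) by blast
  qed
  then have "edge_conn G \<le> size (edges G \<inter># X)" by (intro edge_conn_le) simp_all
  also have "\<dots> \<le> size X" by (intro size_mset_mono) simp
  finally show ?thesis using X(3) by simp
qed

lemma tree_on_join:
  assumes "finite V1" "finite V2" "V1 \<inter> V2 = {}" "V1 \<noteq> {}" "V2 \<noteq> {}"
    and "tree_on V1 T1" "tree_on V2 T2" "a \<in> V1" "b \<in> V2"
  shows "tree_on (V1 \<union> V2) (add_mset {a, b} (T1 + T2))"
proof -
  let ?T = "add_mset {a, b} (T1 + T2)" and ?V = "V1 \<union> V2"
  have T1: "set_mset T1 \<subseteq> edges_on V1" "ncomps V1 (set_mset T1) = 1" "size T1 = card V1 - 1"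
    and T2: "set_mset T2 \<subseteq> edges_on V2" "ncomps V2 (set_mset T2) = 1" "size T2 = card V2 - 1"
    using assms by (auto simp: tree_on_def connected_on_def)
  have "{a, b} \<in> edges_on ?V" using assms by (intro edges_onI) auto
  then have sub: "set_mset ?T \<subseteq> edges_on ?V"
    using T1(1) T2(1) edges_on_mono[of V1 ?V] edges_on_mono[of V2 ?V] by auto
  have "conn (set_mset ?T) a u" if "u \<in> ?V" for u
  proof (cases "u \<in> V1")
    case True
    then have "conn (set_mset T1) a u"
      using T1(2) ncomps_eq_1_iff[OF assms(1,4)] assms(8) by blast
    then show ?thesis by (rule conn_mono) auto
  next
    case False
    then have "conn (set_mset T2) b u"
      using T2(2) ncomps_eq_1_iff[OF assms(2,5)] assms(9) that by blast
    then have "conn (set_mset ?T) b u" by (rule conn_mono) auto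
    moreover have "conn (set_mset ?T) a b" by (rule conn_edge) simp
    ultimately show ?thesis using conn_trans by metis
  qed
  then have "\<forall>u\<in>?V. \<forall>v\<in>?V. conn (set_mset ?T) u v" by (meson conn_sym conn_trans)
  then have "ncomps ?V (set_mset ?T) = 1" using ncomps_eq_1_iff[of ?V] assms by simp
  moreover have "0 < card V1" "0 < card V2" using assms by (auto simp: card_gt_0_iff)
  then have "size ?T = card ?V - 1"
    using T1(3) T2(3) card_Un_disjoint[OF assms(1-3)] by simp
  ultimately show ?thesis using sub by (simp add: tree_on_def connected_on_def)
qed

text \<open>Each pair of trees spends one edge of \<open>K\<close>; as \<open>K\<close> is a
  multiset, parallel crossing edges serve different trees.\<close>

lemma tree_list_join:
  assumes V: "finite V1" "finite V2" "V1 \<inter> V2 = {}" "V1 \<noteq> {}" "V2 \<noteq> {}"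
    and "length Ts1 = length Ts2" "size K = length Ts1"
    and "\<forall>T\<in>set Ts1. tree_on V1 T" "\<forall>T\<in>set Ts2. tree_on V2 T"
    and "\<forall>e\<in>#K. \<exists>a\<in>V1. \<exists>b\<in>V2. e = {a, b}"
  shows "\<exists>Ts. length Ts = length Ts1 \<and> (\<forall>T\<in>set Ts. tree_on (V1 \<union> V2) T) \<and>
    sum_list Ts = sum_list Ts1 + sum_list Ts2 + K"
  using assms(6-)
proof (induction Ts1 Ts2 arbitrary: K rule: list_induct2)
  case Nil
  then show ?case by simp
next
  case (Cons T1 Ts1 T2 Ts2)
  have "size K = Suc (length Ts1)" using Cons.prems by simp
  then obtain e K' where K: "K = add_mset e K'" "size K' = length Ts1"
    by (metis size_eq_Suc_imp_eq_union add_mset_add_single nat.inject size_add_mset)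
  obtain a b where ab: "a \<in> V1" "b \<in> V2" "e = {a, b}" using Cons.prems(4) K by auto
  obtain Ts where Ts: "length Ts = length Ts1" "\<forall>T\<in>set Ts. tree_on (V1 \<union> V2) T"
    "sum_list Ts = sum_list Ts1 + sum_list Ts2 + K'"
    using Cons.IH[of K'] Cons.prems K by auto
  have "tree_on (V1 \<union> V2) (add_mset e (T1 + T2))"
    unfolding ab(3) using Cons.prems(2,3) by (intro tree_on_join V ab) auto
  then show ?case
    using Ts K(1) by (intro exI[of _ "add_mset e (T1 + T2) # Ts"]) simp
qed

section \<open>Extremal graphs\<close>

abbreviation (input) cross :: "'a set \<Rightarrow> 'a set \<Rightarrow> 'a set \<Rightarrow> bool" where
  "cross V1 V2 e \<equiv> e \<inter> V1 \<noteq> {} \<and> e \<inter> V2 \<noteq> {}"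

lemma filter_mset_eq_emptyI: "(\<And>x. x \<in># M \<Longrightarrow> \<not> P x) \<Longrightarrow> filter_mset P M = {#}"
  by (induction M) simp_all

lemma partition_edges:
  assumes "set_mset E \<subseteq> edges_on (V1 \<union> V2)" "V1 \<inter> V2 = {}"
  shows "E = filter_mset (\<lambda>e. e \<subseteq> V1) E + filter_mset (\<lambda>e. e \<subseteq> V2) E + filter_mset (cross V1 V2) E"
proof (rule multiset_eqI)
  fix e
  show "count E e = count (filter_mset (\<lambda>e. e \<subseteq> V1) E + filter_mset (\<lambda>e. e \<subseteq> V2) E +
      filter_mset (cross V1 V2) E) e"
  proof (cases "e \<in># E")
    case True
    then have "e \<in> edges_on (V1 \<union> V2)" using assms(1) by blast
    then obtain a b where "e = {a, b}" "a \<in> V1 \<union> V2" "b \<in> V1 \<union> V2" by (rule edges_onE)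
    then show ?thesis using assms(2) by auto
  next
    case False
    then show ?thesis by (simp add: not_in_iff)
  qed
qed

lemma crossE:
  assumes "e \<in> edges_on (V1 \<union> V2)" "V1 \<inter> V2 = {}" "cross V1 V2 e"
  obtains a b where "a \<in> V1" "b \<in> V2" "e = {a, b}"
proof -
  obtain x y where "e = {x, y}" "x \<in> V1 \<union> V2" "y \<in> V1 \<union> V2" using assms(1) by (rule edges_onE)
  then show ?thesis using that[of x y] that[of y x] assms(2,3) by (auto simp: insert_commute)
qed

lemma edge_conn_le_cross:
  assumes "finite V1" "finite V2" "V1 \<inter> V2 = {}" "V1 \<noteq> {}" "V2 \<noteq> {}"
    and "set_mset E \<subseteq> edges_on (V1 \<union> V2)"
  shows "edge_conn (V1 \<union> V2, E) \<le> size (filter_mset (cross V1 V2) E)"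
proof (rule edge_conn_le)
  let ?D = "E - filter_mset (cross V1 V2) E"
  have "?D = filter_mset (\<lambda>e. \<not> cross V1 V2 e) E" by (rule multiset_eqI) simp
  then have D: "?D \<subseteq># E" "\<And>e. e \<in># ?D \<Longrightarrow> \<not> cross V1 V2 e" by simp_all
  show "\<not> connected_graph (del_edges (V1 \<union> V2, E) (filter_mset (cross V1 V2) E))"
  proof
    assume "connected_graph (del_edges (V1 \<union> V2, E) (filter_mset (cross V1 V2) E))"
    then have "connected_on (V1 \<union> V2) ?D"
      using assms set_mset_mono[OF D(1)]
      by (auto simp: connected_on_def connected_graph_iff del_edges_def)
    then obtain e where "e \<in># ?D" "cross V1 V2 e"
      by (rule connected_on_crossing[OF finite_UnI[OF assms(1,2)] _ refl assms(3-5)]) blast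
    then show False using D(2) by blast
  qed
qed simp

text \<open>The k glued trees give \<tau> \<ge> k and \<kappa>' \<ge> k; only \<open>K\<close>
  crosses between the sides, so \<kappa>' \<le> k, and \<tau> \<le> \<kappa>' gives the rest.
  Minimality holds because any competitor contains k disjoint spanning trees, while this graph
  consists of nothing else.\<close>

lemma Fam_I:
  assumes V: "finite V1" "finite V2" "V1 \<inter> V2 = {}" "V1 \<noteq> {}" "V2 \<noteq> {}"
    and len: "length Ts1 = k" "length Ts2 = k" "size K = k"
    and trees: "\<forall>T\<in>set Ts1. tree_on V1 T" "\<forall>T\<in>set Ts2. tree_on V2 T"
    and K: "\<forall>e\<in>#K. \<exists>a\<in>V1. \<exists>b\<in>V2. e = {a, b}"
  shows "(V1 \<union> V2, sum_list Ts1 + sum_list Ts2 + K) \<in> Fam k (card (V1 \<union> V2))"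
    and "size (sum_list Ts1 + sum_list Ts2 + K) = k * (card (V1 \<union> V2) - 1)"
proof -
  let ?V = "V1 \<union> V2" and ?E = "sum_list Ts1 + sum_list Ts2 + K"
  let ?H = "(?V, ?E)"
  obtain Ts where Ts: "length Ts = k" "\<forall>T\<in>set Ts. tree_on ?V T" "sum_list Ts = ?E"
    using tree_list_join[OF V, of Ts1 Ts2 K] assms by auto
  have pos: "0 < card V1" "0 < card V2" using V by (auto simp: card_gt_0_iff)
  then have card: "2 \<le> card (verts ?H)" using card_Un_disjoint[OF V(1-3)] by simp
  show size: "size ?E = k * (card ?V - 1)"
    using tree_packing_size[OF Ts(2)] unfolding Ts(1,3) .
  have sub: "set_mset (sum_list Us) \<subseteq> edges_on W" if "\<forall>T\<in>set Us. tree_on W T"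
    for Us and W :: "'a set"
    using that by (induction Us) (auto simp: tree_on_def connected_on_def)
  have E: "set_mset ?E \<subseteq> edges_on ?V" using sub[OF Ts(2)] unfolding Ts(3) .
  have wf: "wf_graph ?H" using E V by (simp add: wf_graph_iff)
  have pack: "tree_packing_in ?H Ts" using Ts by (simp add: tree_packing_in_def)
  have "k \<le> edge_conn ?H"
    using length_le_edge_conn[OF _ card pack] V Ts(1) by simp
  moreover have "edge_conn ?H \<le> k"
  proof -
    have "\<not> cross V1 V2 e" if "e \<in># sum_list Ts1 + sum_list Ts2" for e
    proof -
      have "e \<in> edges_on V1 \<union> edges_on V2"
        using that sub[OF trees(1)] sub[OF trees(2)] unfolding set_mset_union by blast
      then show ?thesis using V(3) by (auto simp: edges_on_def)
    qed
    then have "filter_mset (cross V1 V2) (sum_list Ts1 + sum_list Ts2) = {#}"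
      by (rule filter_mset_eq_emptyI)
    then have "filter_mset (cross V1 V2) ?E = filter_mset (cross V1 V2) K"
      by (simp only: filter_union_mset) simp
    then have "edge_conn ?H \<le> size (filter_mset (cross V1 V2) K)"
      using edge_conn_le_cross[OF V E] by (simp only:)
    also have "\<dots> \<le> k" using size_filter_mset_lesseq[of "cross V1 V2" K] len(3) by simp
    finally show ?thesis .
  qed
  ultimately have ec: "edge_conn ?H = k" by simp
  have "k \<le> tree_pack ?H" using tree_pack_ge[OF wf card pack] Ts(1) by simp
  moreover have "tree_pack ?H \<le> k"
  proof -
    obtain Us where Us: "tree_packing_in ?H Us" "length Us = tree_pack ?H"
      by (rule tree_pack_packing[OF wf card])
    then show ?thesis using length_le_edge_conn[OF _ card Us(1)] V ec by simp
  qed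
  ultimately have tp: "tree_pack ?H = k" by simp
  have "size ?E \<le> size (edges H')"
    if H': "wf_graph H'" "card (verts H') = card ?V" "tree_pack H' = k" for H' :: "'a mgraph"
  proof -
    have "2 \<le> card (verts H')" using card H'(2) by simp
    then obtain Us where Us: "tree_packing_in H' Us" "length Us = k"
      using tree_pack_packing[OF H'(1)] H'(3) by auto
    then have "k * (card ?V - 1) = size (sum_list Us)"
      using tree_packing_size[of Us "verts H'"] H'(2) by (simp add: tree_packing_in_def)
    also have "\<dots> \<le> size (edges H')"
      using Us(1) by (intro size_mset_mono) (simp add: tree_packing_in_def)
    finally show ?thesis using size by simp
  qed
  then have "\<forall>H'::'a mgraph. wf_graph H' \<and> card (verts H') = card ?V \<and> edge_conn H' = k \<and>
      tree_pack H' = k \<longrightarrow> size ?E \<le> size (edges H')"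
    by blast
  with wf ec tp show "?H \<in> Fam k (card ?V)" unfolding Fam_def mem_Collect_eq verts_Pair edges_Pair
    by (intro conjI refl)
qed

text \<open>To exploit minimality a competitor with exactly k(n - 1) edges must exist. It is built
  on the vertices of \<open>H\<close> itself: k copies of a tree on all vertices but
  \<open>v\<close>, and k parallel edges at \<open>v\<close>. The tree on {v} is empty.\<close>

lemma Fam_size:
  assumes "H \<in> Fam k n" "2 \<le> n"
  shows "size (edges H) \<le> k * (n - 1)"
proof -
  let ?V = "verts H"
  have H: "finite ?V" "card ?V = n" using assms(1) by (auto simp: Fam_def wf_graph_iff)
  obtain v where v: "v \<in> ?V" using H assms(2) by fastforce
  have ne: "?V - {v} \<noteq> {}"
  proof
    assume "?V - {v} = {}"
    then have "?V = {v}" using v by blast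
    then show False using H(2) assms(2) by simp
  qed
  then obtain w where w: "w \<in> ?V - {v}" by blast
  have tree: "\<exists>T. tree_on W T" if "finite W" "W \<noteq> {}" for W :: "'a set"
    using extend_to_tree[OF that empty_subsetI graphic.indep_empty] by blast
  obtain T1 where T1: "tree_on {v} T1" using tree[of "{v}"] by blast
  obtain T2 where T2: "tree_on (?V - {v}) T2" using tree[OF _ ne] H(1) by blast
  let ?E = "sum_list (replicate k T1) + sum_list (replicate k T2) + replicate_mset k {v, w}"
  have "({v} \<union> (?V - {v}), ?E) \<in> Fam k (card ({v} \<union> (?V - {v})))"
    and size: "size ?E = k * (card ({v} \<union> (?V - {v})) - 1)"
    by (rule Fam_I; use H(1) ne T1 T2 w in auto)+
  moreover have V: "{v} \<union> (?V - {v}) = ?V" using v by blast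
  ultimately have "(?V, ?E) \<in> Fam k n" unfolding V H(2) by simp
  then have H': "wf_graph (?V, ?E)" "card (verts (?V, ?E)) = n" "edge_conn (?V, ?E) = k"
    "tree_pack (?V, ?E) = k"
    unfolding Fam_def by blast+
  have "size (edges H) \<le> size (edges (?V, ?E))"
    using assms(1) H' unfolding Fam_def by blast
  then have "size (edges H) \<le> size ?E" by simp
  then show ?thesis using size unfolding V H(2) by simp
qed

text \<open>There is no slack: as many lists entries as crossings, each entry with at least
  one.\<close>

lemma size_crossing_filter:
  assumes "\<And>T. T \<in> set Ts \<Longrightarrow> 1 \<le> size (filter_mset P T)"
    and "size (filter_mset P (sum_list Ts)) \<le> length Ts" "T \<in> set Ts"
  shows "size (filter_mset P T) = 1"
  using assms
proof (induction Ts)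
  case (Cons S Ts)
  have "length Ts * 1 \<le> size (filter_mset P (sum_list Ts))"
    using Cons.prems(1) by (intro size_filter_sum_list_ge) auto
  moreover have "1 \<le> size (filter_mset P S)" using Cons.prems(1) by simp
  moreover have "size (filter_mset P S) + size (filter_mset P (sum_list Ts)) \<le> length Ts + 1"
    using Cons.prems(2) by simp
  ultimately have "size (filter_mset P S) = 1" "size (filter_mset P (sum_list Ts)) \<le> length Ts"
    by linarith+
  then show ?case using Cons.IH Cons.prems(1,3) by (cases "T = S") simp_all
qed simp

text \<open>A path of \<open>T\<close> that leaves \<open>V1\<close> returns through the only crossing edge, hence to the same vertex.\<close>
lemma connected_on_restrict:
  assumes "finite V" "connected_on V T" "V1 \<union> V2 = V" "V1 \<inter> V2 = {}" "V1 \<noteq> {}"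
    and "size (filter_mset (cross V1 V2) T) = 1"
  shows "connected_on V1 (filter_mset (\<lambda>e. e \<subseteq> V1) T)"
proof -
  let ?T1 = "filter_mset (\<lambda>e. e \<subseteq> V1) T"
  have T: "set_mset T \<subseteq> edges_on V" "ncomps V (set_mset T) = 1"
    using assms(2) by (auto simp: connected_on_def)
  obtain c where c: "filter_mset (cross V1 V2) T = {#c#}"
    using size_1_singleton_mset[OF assms(6)] by blast
  then have "c \<in># filter_mset (cross V1 V2) T" by simp
  then have "c \<in> edges_on (V1 \<union> V2)" "cross V1 V2 c" using T(1) assms(3) by auto
  then obtain a b where ab: "a \<in> V1" "b \<in> V2" "c = {a, b}" using crossE[OF _ assms(4)] by metis
  have a: "conn (set_mset ?T1) a v" if v: "v \<in> V1" for v
  proof -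
    have conn: "conn (set_mset T) a v"
      using T(2) ncomps_eq_1_iff[of V "set_mset T"] assms(1,3) ab(1) v by blast
    have "v \<in> V2 \<union> {v. conn (set_mset ?T1) a v}"
    proof (rule conn_stays[OF conn])
      show "a \<in> V2 \<union> {v. conn (set_mset ?T1) a v}" by simp
      fix x y assume xy: "{x, y} \<in># T" "x \<in> V2 \<union> {v. conn (set_mset ?T1) a v}"
      have V: "x \<in> V1 \<union> V2" "y \<in> V1 \<union> V2" using xy(1) T(1) assms(3) by (auto simp: edges_on_def)
      show "y \<in> V2 \<union> {v. conn (set_mset ?T1) a v}"
      proof (cases "y \<in> V2")
        case False
        then have y: "y \<in> V1" using V by blast
        show ?thesis
        proof (cases "x \<in> V2")
          case True
          then have "{x, y} \<in># filter_mset (cross V1 V2) T" using xy(1) y by simp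
          then have "{x, y} = {a, b}" unfolding c ab(3) by simp
          then have "y = a" using y ab(2) assms(4) by (auto simp: doubleton_eq_iff)
          then show ?thesis by simp
        next
          case False
          then have "{x, y} \<in># ?T1" using V y xy(1) by simp
          then show ?thesis using xy(2) False conn_edge conn_trans by (metis Un_iff mem_Collect_eq)
        qed
      qed simp
    qed
    then show ?thesis using v assms(4) by blast
  qed
  have "finite V1" using assms(1,3) by auto
  moreover have "\<forall>u\<in>V1. \<forall>v\<in>V1. conn (set_mset ?T1) u v" using a conn_sym conn_trans by metis
  moreover have "set_mset ?T1 \<subseteq> edges_on V1" using T(1) by (auto simp: edges_on_def)
  ultimately show ?thesis using ncomps_eq_1_iff[of V1] assms(5) by (simp add: connected_on_def)
qed

lemma filter_sum_list: "filter_mset P (sum_list Ts) = sum_list (map (filter_mset P) Ts)"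
  by (induction Ts) simp_all

lemma eta_of_packing:
  assumes "finite V" "V \<noteq> {}" "set_mset E \<subseteq> edges_on V" "0 < k" "length Ts = k"
    and "\<And>T. T \<in> set Ts \<Longrightarrow> connected_on V T" "sum_list Ts \<subseteq># E"
  shows "connected_graph (V, E)" "real k \<le> eta (V, E) \<or> card V = 1"
proof -
  have cut: "k * (ncomps V (set_mset (E - X)) - 1) \<le> size X" for X
    using packing_cut[OF assms(1,6,7)] assms(5) by simp
  \<comment> \<open>With \<open>X\<close> empty the cut inequality reads k(c - 1) \<le> 0, and k is
    positive.\<close>
  have "ncomps V (set_mset E) = 1"
    using cut[of "{#}"] assms(4) ncomps_pos[OF assms(1,2), of "set_mset E"] by simp
  then show "connected_graph (V, E)" using connected_graph_iff_ncomps[OF assms(1)] assms(2) by blast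
  show "real k \<le> eta (V, E) \<or> card V = 1"
  proof (cases "2 \<le> card V")
    case True
    then show ?thesis using eta_ge_iff[OF assms(1) True \<open>ncomps V (set_mset E) = 1\<close>] cut by blast
  next
    case False
    moreover have "0 < card V" using assms(1,2) by (simp add: card_gt_0_iff)
    ultimately show ?thesis by simp
  qed
qed

lemma packing_of_eta:
  assumes "finite V" "set_mset E \<subseteq> edges_on V" "connected_graph (V, E)"
    and "real k \<le> eta (V, E) \<or> card V = 1"
  obtains Ts where "length Ts = k" "\<forall>T\<in>set Ts. tree_on V T" "sum_list Ts \<subseteq># E"
proof (rule tree_packing[OF assms(1) _ assms(2)])
  have V: "V \<noteq> {}" "ncomps V (set_mset E) = 1"
    using assms(3) connected_graph_iff_ncomps[OF assms(1)] by auto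
  show "V \<noteq> {}" by (rule V)
  fix X assume X: "X \<subseteq># E"
  show "k * (ncomps V (set_mset (E - X)) - 1) \<le> size X"
  \<comment> \<open>For a single vertex \<open>eta\<close> is a minimum over the empty set and gives
    no information; here c - 1 = 0, and the trees obtained are empty.\<close>
  proof (cases "card V = 1")
    case True
    then show ?thesis using ncomps_le_card[OF assms(1), of "set_mset (E - X)"] by simp
  next
    case False
    then have "2 \<le> card V" using V(1) assms(1) by (metis One_nat_def Suc_leI card_gt_0_iff le_neq_implies_less numeral_2_eq_2)
    then show ?thesis using eta_ge_iff[OF assms(1) _ V(2)] assms(4) False X by blast
  qed
qed

lemma min_cut_partition:
  assumes "wf_graph G" "2 \<le> card (verts G)"
  obtains V1 V2 where "V1 \<union> V2 = verts G" "V1 \<inter> V2 = {}" "V1 \<noteq> {}" "V2 \<noteq> {}"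
    "size (filter_mset (cross V1 V2) (edges G)) \<le> edge_conn G"
proof -
  have G: "finite (verts G)" "set_mset (edges G) \<subseteq> edges_on (verts G)" "verts G \<noteq> {}"
    using assms by (auto simp: wf_graph_iff)
  obtain X where X: "X \<subseteq># edges G" "\<not> connected_graph (verts G, edges G - X)"
    "size X = edge_conn G"
    by (rule edge_conn_cut[OF G(1) assms(2)]) (auto simp: del_edges_def)
  obtain V1 V2 where V12: "V1 \<union> V2 = verts G" "V1 \<inter> V2 = {}" "V1 \<noteq> {}" "V2 \<noteq> {}"
    and nc: "\<And>e. e \<in># edges G - X \<Longrightarrow> e \<in> edges_on (verts G) \<Longrightarrow> e \<inter> V1 = {} \<or> e \<inter> V2 = {}"
    by (rule disconnected_cut[OF G(1,3) X(2)]) blast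
  have "filter_mset (cross V1 V2) (edges G) \<subseteq># X"
  proof (rule mset_subset_eqI)
    fix e
    show "count (filter_mset (cross V1 V2) (edges G)) e \<le> count X e"
    proof (cases "e \<in># edges G \<and> cross V1 V2 e")
      case True
      then have "e \<notin># edges G - X" using nc G(2) by blast
      then show ?thesis using True by (simp add: in_diff_count)
    next
      case False
      then show ?thesis by (auto simp: not_in_iff)
    qed
  qed
  then have "size (filter_mset (cross V1 V2) (edges G)) \<le> edge_conn G"
    unfolding X(3)[symmetric] by (rule size_mset_mono)
  then show ?thesis by (rule that[OF V12])
qed

section \<open>The four implications\<close>

lemma Fam_D:
  assumes "H \<in> Fam k n"
  shows "wf_graph H" "card (verts H) = n" "edge_conn H = k" "tree_pack H = k"
  using assms by (auto simp: Fam_def)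

lemma Fam_packing:
  assumes "H \<in> Fam k n" "2 \<le> n"
  obtains Ts where "length Ts = k" "\<And>T. T \<in> set Ts \<Longrightarrow> tree_on (verts H) T"
    "sum_list Ts \<subseteq># edges H"
proof -
  note H = Fam_D[OF assms(1)]
  have "2 \<le> card (verts H)" using H(2) assms(2) by simp
  then obtain Ts where "tree_packing_in H Ts" "length Ts = k"
    using tree_pack_packing[OF H(1)] H(4) by metis
  then show ?thesis using that by (auto simp: tree_packing_in_def)
qed

lemma restrict_edges_on:
  "set_mset E \<subseteq> edges_on V \<Longrightarrow> set_mset (filter_mset (\<lambda>e. e \<subseteq> W) E) \<subseteq> edges_on W"
  by (auto simp: edges_on_def)

text \<open>The sides come from a minimum cut of \<open>H\<close>, not of \<open>G\<close>. At most
  k edges of \<open>H\<close> cross it and each of the k trees needs one, so each tree crosses once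
  and restricts to both sides. Further edges of \<open>G\<close> may cross, hence k' \<ge>
  k.\<close>

lemma edge_join_of_Fam:
  assumes V: "finite V" "2 \<le> n" and E: "set_mset E \<subseteq> edges_on V" and "0 < k"
    and "spanning_subgraph H (V, E)" "H \<in> Fam k n"
  obtains k' V1 V2 where "k \<le> k'" "edge_join (V, E) V1 V2 k'"
    "eta (induced (V, E) V1) \<ge> real k \<or> card V1 = 1"
    "eta (induced (V, E) V2) \<ge> real k \<or> card V2 = 1"
proof -
  note H = Fam_D[OF assms(6)]
  have HV: "verts H = V" "edges H \<subseteq># E" using assms(5) by (auto simp: spanning_subgraph_def)
  obtain Ts where len: "length Ts = k" and tree: "\<And>T. T \<in> set Ts \<Longrightarrow> tree_on (verts H) T"
    and sum: "sum_list Ts \<subseteq># edges H"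
    by (rule Fam_packing[OF assms(6) V(2)]) blast
  have "2 \<le> card V" using H(2) V(2) HV(1) by simp
  then obtain V1 V2 where V12: "V1 \<union> V2 = V" "V1 \<inter> V2 = {}" "V1 \<noteq> {}" "V2 \<noteq> {}"
    and le: "size (filter_mset (cross V1 V2) (edges H)) \<le> k"
    by (rule min_cut_partition[OF H(1), unfolded H(3) HV(1)])
  have fin: "finite V1" "finite V2" using V(1) V12(1) by auto
  have T: "connected_on V T" if "T \<in> set Ts" for T
    using tree[OF that] HV(1) by (simp add: tree_on_def)
  have sumE: "sum_list Ts \<subseteq># E" using sum HV(2) by (rule subset_mset.trans)
  have "size (filter_mset (cross V1 V2) (sum_list Ts)) \<le> length Ts"
    using size_mset_mono[OF multiset_filter_mono[OF sum, of "cross V1 V2"]] le len by simp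
  moreover have ge: "1 \<le> size (filter_mset (cross V1 V2) T)" if T_in: "T \<in> set Ts" for T
  proof -
    obtain e where "e \<in># T" "cross V1 V2 e"
      by (rule connected_on_crossing[OF V(1) T[OF T_in] V12]) blast
    then have "e \<in># filter_mset (cross V1 V2) T" by simp
    then have "filter_mset (cross V1 V2) T \<noteq> {#}" by auto
    then show ?thesis unfolding nonempty_has_size by simp
  qed
  ultimately have one: "size (filter_mset (cross V1 V2) T) = 1" if "T \<in> set Ts" for T
    using size_crossing_filter[of Ts "cross V1 V2" T] that by blast
  have side: "connected_graph (W, filter_mset (\<lambda>e. e \<subseteq> W) E)"
      "real k \<le> eta (W, filter_mset (\<lambda>e. e \<subseteq> W) E) \<or> card W = 1"
    if W: "finite W" "W \<noteq> {}" "\<And>T. T \<in> set Ts \<Longrightarrow> connected_on W (filter_mset (\<lambda>e. e \<subseteq> W) T)"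
    for W
  proof -
    have "sum_list (map (filter_mset (\<lambda>e. e \<subseteq> W)) Ts) \<subseteq># filter_mset (\<lambda>e. e \<subseteq> W) E"
      unfolding filter_sum_list[symmetric] by (rule multiset_filter_mono[OF sumE])
    then show "connected_graph (W, filter_mset (\<lambda>e. e \<subseteq> W) E)"
      "real k \<le> eta (W, filter_mset (\<lambda>e. e \<subseteq> W) E) \<or> card W = 1"
      using eta_of_packing[OF W(1,2) restrict_edges_on[OF E] assms(4),
          of "map (filter_mset (\<lambda>e. e \<subseteq> W)) Ts"] W(3) len by auto
  qed
  have side1: "connected_graph (induced (V, E) V1)" "eta (induced (V, E) V1) \<ge> real k \<or> card V1 = 1"
    using side[OF fin(1) V12(3) connected_on_restrict[OF V(1) T V12(1-3) one]]
    by (simp_all add: induced_def)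
  have V21: "V2 \<union> V1 = V" "V2 \<inter> V1 = {}" using V12 by auto
  have one': "size (filter_mset (cross V2 V1) T) = 1" if "T \<in> set Ts" for T
    using one[OF that] by (simp add: conj_commute)
  have side2: "connected_graph (induced (V, E) V2)" "eta (induced (V, E) V2) \<ge> real k \<or> card V2 = 1"
    using side[OF fin(2) V12(4) connected_on_restrict[OF V(1) T V21 V12(4) one']]
    by (simp_all add: induced_def)
  have "length Ts * 1 \<le> size (filter_mset (cross V1 V2) (sum_list Ts))"
    using ge by (rule size_filter_sum_list_ge)
  also have "\<dots> \<le> size (filter_mset (cross V1 V2) E)"
    by (intro size_mset_mono multiset_filter_mono sumE)
  finally have "k \<le> size (filter_mset (cross V1 V2) E)" using len by simp
  moreover have "edge_join (V, E) V1 V2 (size (filter_mset (cross V1 V2) E))"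
    using side1(1) side2(1) V12 by (simp add: edge_join_def)
  ultimately show ?thesis by (rule that[OF _ _ side1(2) side2(2)])
qed

text \<open>Only k of the k' crossing edges and k disjoint trees on each side are kept; all other
  edges of \<open>G\<close> are dropped.\<close>

lemma Fam_of_edge_join:
  assumes V: "finite V" and E: "set_mset E \<subseteq> edges_on V"
    and "k \<le> k'" "edge_join (V, E) V1 V2 k'"
    and "eta (induced (V, E) V1) \<ge> real k \<or> card V1 = 1"
    and "eta (induced (V, E) V2) \<ge> real k \<or> card V2 = 1"
  obtains H where "spanning_subgraph H (V, E)" "H \<in> Fam k (card V)"
proof -
  have V12: "V1 \<inter> V2 = {}" "V1 \<union> V2 = V"
    and con: "connected_graph (V1, filter_mset (\<lambda>e. e \<subseteq> V1) E)"
      "connected_graph (V2, filter_mset (\<lambda>e. e \<subseteq> V2) E)"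
    and k': "size (filter_mset (cross V1 V2) E) = k'"
    using assms(4) by (simp_all add: edge_join_def induced_def)
  have fin: "finite V1" "finite V2" using V V12(2) by auto
  have ne: "V1 \<noteq> {}" "V2 \<noteq> {}" using con by (auto simp: connected_graph_def)
  obtain Ts1 where Ts1: "length Ts1 = k" "\<forall>T\<in>set Ts1. tree_on V1 T"
    "sum_list Ts1 \<subseteq># filter_mset (\<lambda>e. e \<subseteq> V1) E"
    using packing_of_eta[OF fin(1) restrict_edges_on[OF E] con(1)] assms(5)
    unfolding induced_def edges_Pair by blast
  obtain Ts2 where Ts2: "length Ts2 = k" "\<forall>T\<in>set Ts2. tree_on V2 T"
    "sum_list Ts2 \<subseteq># filter_mset (\<lambda>e. e \<subseteq> V2) E"
    using packing_of_eta[OF fin(2) restrict_edges_on[OF E] con(2)] assms(6)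
    unfolding induced_def edges_Pair by blast
  obtain K where K: "K \<subseteq># filter_mset (cross V1 V2) E" "size K = k"
    using ex_submultiset_of_size[of k "filter_mset (cross V1 V2) E"] assms(3) k' by blast
  have "\<exists>a\<in>V1. \<exists>b\<in>V2. e = {a, b}" if "e \<in># K" for e
  proof -
    have "e \<in># filter_mset (cross V1 V2) E" using mset_subset_eqD[OF K(1) that] .
    then have "e \<in> edges_on (V1 \<union> V2)" "cross V1 V2 e" using E V12(2) by auto
    then show ?thesis using crossE[OF _ V12(1)] by metis
  qed
  then have "(V1 \<union> V2, sum_list Ts1 + sum_list Ts2 + K) \<in> Fam k (card (V1 \<union> V2))"
    using Fam_I(1)[OF fin V12(1) ne Ts1(1) Ts2(1) K(2) Ts1(2) Ts2(2)] by blast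
  moreover have "sum_list Ts1 + sum_list Ts2 + K \<subseteq># E"
    by (subst partition_edges[of E V1 V2])
      (use E V12 Ts1(3) Ts2(3) K(1) in \<open>auto intro!: subset_mset.add_mono\<close>)
  ultimately show ?thesis unfolding V12(2) by (intro that) (simp_all add: spanning_subgraph_def)
qed

lemma sparse_of_Fam:
  assumes V: "finite V" "V \<noteq> {}" "2 \<le> n" and "spanning_subgraph (V, E) H" "H \<in> Fam k n"
    and WD: "W \<subseteq> V" "D \<subseteq># E" "set_mset D \<subseteq> edges_on W"
  shows "size D \<le> k * (card W - ncomps W (set_mset D))"
proof -
  have HV: "verts H = V" "E \<subseteq># edges H" using assms(4) by (auto simp: spanning_subgraph_def)
  obtain Ts where len: "length Ts = k" and T: "\<And>T. T \<in> set Ts \<Longrightarrow> tree_on V T"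
    and sum: "sum_list Ts \<subseteq># edges H"
    using Fam_packing[OF assms(5) V(3)] HV(1) by metis
  \<comment> \<open>Minimality of \<open>H\<close> leaves no edge outside its k trees.\<close>
  have "size (edges H) \<le> size (sum_list Ts)"
    using Fam_size[OF assms(5) V(3)] tree_packing_size[of Ts V] T len Fam_D(2)[OF assms(5)] HV(1)
    by auto
  then have "edges H = sum_list Ts"
    using sum mset_subset_size[of "sum_list Ts" "edges H"]
    by (metis not_le subset_mset.le_imp_less_or_eq)
  then have ET: "E \<subseteq># sum_list Ts" using HV(2) by simp
  \<comment> \<open>How \<open>D\<close> splits among the trees is not determined, so all tree edges
    on \<open>W\<close> spanned by \<open>D\<close> are counted instead: they include
    \<open>D\<close> and leave the component bound unchanged.\<close>
  let ?P = "\<lambda>e. e \<in> edge_cl (set_mset D) \<and> e \<in> edges_on W"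
  have "D = filter_mset ?P D"
    using WD(3) by (subst filter_mset_eq_conv[THEN iffD2]) (auto simp: edge_cl_def)
  moreover have "D \<subseteq># sum_list Ts" using WD(2) ET by (rule subset_mset.trans)
  ultimately have "D \<subseteq># filter_mset ?P (sum_list Ts)" using multiset_filter_mono by metis
  then have "size D \<le> size (filter_mset ?P (sum_list Ts))" by (rule size_mset_mono)
  also have "\<dots> \<le> length Ts * (card W - ncomps W (set_mset D))"
  proof (rule size_filter_sum_list_le)
    fix T assume "T \<in> set Ts"
    then have "size (filter_mset ?P T) \<le> card W - ncomps W (set_mset (filter_mset ?P T))"
      using T by (intro tree_subset_size[OF V(1) _ V(2) _ WD(1)]) auto
    moreover have "ncomps W (set_mset D) \<le> ncomps W (set_mset (filter_mset ?P T))"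
    proof (rule ncomps_antimono)
      show "finite W" using WD(1) V(1) by (rule finite_subset)
      fix u v assume "conn (set_mset (filter_mset ?P T)) u v"
      then have "conn (edge_cl (set_mset D)) u v" by (rule conn_mono) auto
      then show "conn (set_mset D) u v" by (simp add: conn_edge_cl)
    qed
    ultimately show "size (filter_mset ?P T) \<le> card W - ncomps W (set_mset D)" by simp
  qed
  finally show ?thesis using len by simp
qed

text \<open>A minimum cut of the given graph has at most k edges. Sparsity passes to both sides and
  yields k covering trees on each, so only the cut has to be filled up.\<close>

lemma Fam_of_sparse:
  assumes V: "finite V" "2 \<le> card V" and E: "set_mset E \<subseteq> edges_on V"
    and "edge_conn (V, E) \<le> k"
    and sparse: "\<And>W D. \<lbrakk>W \<subseteq> V; D \<subseteq># E; set_mset D \<subseteq> edges_on W\<rbrakk> \<Longrightarrow>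
      size D \<le> k * (card W - ncomps W (set_mset D))"
  obtains H where "spanning_subgraph (V, E) H" "H \<in> Fam k (card V)"
proof -
  have "wf_graph (V, E)" using V(1) E by (simp add: wf_graph_iff)
  then obtain V1 V2 where V12: "V1 \<union> V2 = V" "V1 \<inter> V2 = {}" "V1 \<noteq> {}" "V2 \<noteq> {}"
    and "size (filter_mset (cross V1 V2) E) \<le> edge_conn (V, E)"
    by (rule min_cut_partition[of "(V, E)", unfolded verts_Pair edges_Pair, OF _ V(2)])
  then have le: "size (filter_mset (cross V1 V2) E) \<le> k" using assms(4) by simp
  have fin: "finite V1" "finite V2" using V(1) V12(1) by auto
  have cover: "\<exists>Ts. length Ts = k \<and> (\<forall>T\<in>set Ts. tree_on W T) \<and>
      filter_mset (\<lambda>e. e \<subseteq> W) E \<subseteq># sum_list Ts"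
    if W: "finite W" "W \<noteq> {}" "W \<subseteq> V" for W
  proof -
    have "size D \<le> k * (card W - ncomps W (set_mset D))" if D: "D \<subseteq># filter_mset (\<lambda>e. e \<subseteq> W) E" for D
    proof (rule sparse[OF W(3)])
      show "D \<subseteq># E" using D multiset_filter_subset by (rule subset_mset.trans)
      show "set_mset D \<subseteq> edges_on W" using set_mset_mono[OF D] restrict_edges_on[OF E] by (rule subset_trans)
    qed
    then show ?thesis using tree_covering[OF W(1,2) restrict_edges_on[OF E]] by metis
  qed
  obtain Ts1 where Ts1: "length Ts1 = k" "\<forall>T\<in>set Ts1. tree_on V1 T"
    "filter_mset (\<lambda>e. e \<subseteq> V1) E \<subseteq># sum_list Ts1"
    using cover[OF fin(1) V12(3)] V12(1) by blast
  obtain Ts2 where Ts2: "length Ts2 = k" "\<forall>T\<in>set Ts2. tree_on V2 T"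
    "filter_mset (\<lambda>e. e \<subseteq> V2) E \<subseteq># sum_list Ts2"
    using cover[OF fin(2) V12(4)] V12(1) by blast
  obtain a b where ab: "a \<in> V1" "b \<in> V2" using V12(3,4) by blast
  let ?C = "filter_mset (cross V1 V2) E"
  \<comment> \<open>The crossing edges are padded with parallel copies of one arbitrary crossing
    pair to exactly k, one for each pair of trees.\<close>
  define K where "K = ?C + replicate_mset (k - size ?C) {a, b}"
  have K: "size K = k" using le by (simp add: K_def)
  have "\<exists>a\<in>V1. \<exists>b\<in>V2. e = {a, b}" if "e \<in># K" for e
  proof (cases "e \<in># ?C")
    case True
    then have "e \<in> edges_on (V1 \<union> V2)" "cross V1 V2 e" using E V12(1) by auto
    then show ?thesis using crossE[OF _ V12(2)] by metis
  next
    case False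
    then have "e = {a, b}" using that by (auto simp: K_def split: if_splits)
    then show ?thesis using ab by blast
  qed
  then have "(V1 \<union> V2, sum_list Ts1 + sum_list Ts2 + K) \<in> Fam k (card (V1 \<union> V2))"
    using Fam_I(1)[OF fin V12(2-4) Ts1(1) Ts2(1) K Ts1(2) Ts2(2)] by blast
  moreover have "E \<subseteq># sum_list Ts1 + sum_list Ts2 + K"
  proof -
    have "?C \<subseteq># K" by (simp add: K_def)
    then show ?thesis
      by (subst partition_edges[of E V1 V2])
        (use E V12(1,2) Ts1(3) Ts2(3) in \<open>auto intro!: subset_mset.add_mono\<close>)
  qed
  ultimately show ?thesis unfolding V12(1) by (intro that) (simp_all add: spanning_subgraph_def)
qed

theorem theorem5p1:
  fixes G :: "'a mgraph" and k n :: nat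
  assumes "wf_graph G" and "k > 0" and "n \<ge> 2"
    and "card (verts G) = n" and "connected_graph G"
  shows "((\<exists>H. spanning_subgraph H G \<and> H \<in> Fam k n) \<longleftrightarrow>
           (\<exists>k' V1 V2. k' \<ge> k \<and> edge_join G V1 V2 k' \<and>
              (eta (induced G V1) \<ge> real k \<or> card V1 = 1) \<and>
              (eta (induced G V2) \<ge> real k \<or> card V2 = 1))) \<and>
         ((\<exists>H. spanning_subgraph G H \<and> H \<in> Fam k n) \<longleftrightarrow>
           edge_conn G \<le> k \<and> gamma G \<le> real k)"
proof -
  obtain V E where G: "G = (V, E)" by (cases G)
  have V: "finite V" "V \<noteq> {}" "card V = n" and E: "set_mset E \<subseteq> edges_on V"
    using assms by (auto simp: wf_graph_iff G)
  \<comment> \<open>Needed so that \<open>gamma G\<close> is a maximum over a nonempty set.\<close>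
  have "E \<noteq> {#}"
  proof
    assume "E = {#}"
    then have "n = 1" using assms(5) V unfolding G by (simp add: connected_graph_iff)
    then show False using assms(3) by simp
  qed
  then have gamma: "gamma G \<le> real k \<longleftrightarrow>
    (\<forall>W D. W \<subseteq> V \<and> D \<subseteq># E \<and> set_mset D \<subseteq> edges_on W \<longrightarrow>
       size D \<le> k * (card W - ncomps W (set_mset D)))"
    using gamma_le_iff[OF assms(1)] V(2) unfolding G by simp
  have "edge_conn G \<le> k \<and> gamma G \<le> real k" if H: "spanning_subgraph G H" "H \<in> Fam k n" for H
  proof
    have "2 \<le> card (verts H)" using Fam_D(2)[OF H(2)] assms(3) by simp
    then show "edge_conn G \<le> k"
      using edge_conn_mono[OF Fam_D(1)[OF H(2)] _ H(1)] Fam_D(3)[OF H(2)] by simp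
    show "gamma G \<le> real k"
      unfolding gamma using sparse_of_Fam[OF V(1,2) assms(3) H[unfolded G]] by blast
  qed
  moreover have "\<exists>H. spanning_subgraph G H \<and> H \<in> Fam k n"
    if conn_le: "edge_conn G \<le> k" and gamma_le: "gamma G \<le> real k"
  proof -
    have "2 \<le> card V" using V(3) assms(3) by simp
    moreover have "size D \<le> k * (card W - ncomps W (set_mset D))"
      if "W \<subseteq> V" "D \<subseteq># E" "set_mset D \<subseteq> edges_on W" for W D
      using gamma_le that unfolding gamma by blast
    ultimately obtain H where "spanning_subgraph (V, E) H" "H \<in> Fam k (card V)"
      using Fam_of_sparse[OF V(1) _ E conn_le[unfolded G]] by metis
    then show ?thesis unfolding G V(3) by blast
  qed
  moreover have "\<exists>H. spanning_subgraph H G \<and> H \<in> Fam k n"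
    if "k \<le> k'" "edge_join G V1 V2 k'" "eta (induced G V1) \<ge> real k \<or> card V1 = 1"
      "eta (induced G V2) \<ge> real k \<or> card V2 = 1" for k' V1 V2
    using Fam_of_edge_join[OF V(1) E that[unfolded G]] unfolding G V(3) by blast
  moreover have "\<exists>k' V1 V2. k' \<ge> k \<and> edge_join G V1 V2 k' \<and>
      (eta (induced G V1) \<ge> real k \<or> card V1 = 1) \<and> (eta (induced G V2) \<ge> real k \<or> card V2 = 1)"
    if "spanning_subgraph H G" "H \<in> Fam k n" for H
    by (rule edge_join_of_Fam[OF V(1) assms(3) E assms(2) that[unfolded G]]) (unfold G, blast)
  ultimately show ?thesis by blast
qed

end
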